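(* Let $f_0(x)=x$ on $[0,1]$ and $\vartheta_0=\int_0^1f_0(x)\,dx=1/2$. Let $(K_n)$ be positive integers with $K_n\le n/\log n$, $K_n\to\infty$, and let $t_j=j/K_n$. Consider the prior on $\mathbf{a}\in\mathbb{R}^{K_n}$ with Lebesgue density $\pi(\mathbf{a})=\prod_{j=1}^{K_n}g(a_j)$, $g=(2R)^{-1}\mathbf{1}_{[-R,R]}$ for a fixed $R>3$, with $\mathbf{a}$ parametrizing $f=\sum_{j=1}^{K_n}a_j\mathbf{1}_{[t_{j-1},t_j)}$, and let $\vartheta=\int_0^1 f$. Then $$E_{f_0}\Big[\Big\|\Pi(\vartheta\in\cdot\mid N)-\mathcal{N}\Big(\widehat\vartheta^{\mathrm{MLE}}-\frac{K_n}{n},\frac{K_n}{n^2}\Big)\Big\|_{\mathrm{TV}}\Big]\to0,$$ and, for $0<\alpha<1$, $$I(\alpha)=\Big[\widehat\vartheta^{\mathrm{MLE}}-\frac{K_n}{n}+\frac{\sqrt{K_n}}{n}\Phi^{-1}(\alpha/2),\ \widehat\vartheta^{\mathrm{MLE}}-\frac{K_n}{n}+\frac{\sqrt{K_n}}{n}\Phi^{-1}(1-\alpha/2)\Big]$$ is an asymptotic $(1-\alpha)$-credible set. On the other hand, if $K_n=o(n^{4/7})$ and $\rho_n=2^{-8}\big(nK_n^{-3/2}\wedge n^2K_n^{-7/2}\big)$, then $$P_{f_0}\Big(\vartheta_0\le\widehat\vartheta^{\mathrm{MLE}}-\frac{K_n}{n}+\frac{\sqrt{K_n}}{n}\rho_n\Big)\to0,$$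 and in particular $I(\alpha)$ has asymptotically no frequentist coverage: $P_{f_0}(\vartheta_0\in I(\alpha))\to0$.
   Context: Model: $P_f$ (expectation $E_f$) is the law of a Poisson point process $N=\sum_i\delta_{(X_i,Y_i)}$ on $[0,1]\times\mathbb{R}$ with intensity $n\mathbf{1}(f(x)\le y)$ with respect to Lebesgue measure. With $f_{\mathbf{a}}=\sum_j a_j\mathbf{1}_{[t_{j-1},t_j)}$, the posterior on $\mathbb{R}^{K_n}$ is $$\Pi(B\mid N)=\frac{\int_B e^{n\int_0^1 f_{\mathbf{a}}}\mathbf{1}(\forall i:f_{\mathbf{a}}(X_i)\le Y_i)\prod_j g(a_j)\,d\mathbf{a}}{\int_{\mathbb{R}^{K_n}}e^{n\int_0^1 f_{\mathbf{a}}}\mathbf{1}(\forall i:f_{\mathbf{a}}(X_i)\le Y_i)\prod_jg(a_j)\,d\mathbf{a}},$$ and $\Pi(\vartheta\in\cdot\mid N)$ is the induced marginal posterior of $\vartheta=\int_0^1 f_{\mathbf a}$. The MLE over piecewise constant functions with jumps at the $t_j$ is $\widehat f^{\mathrm{MLE}}=\sum_{j}\widehat a_j\mathbf{1}_{[t_{j-1},t_j)}$ with $\widehat a_j=\min_{i:X_i\in[t_{j-1},t_j)}Y_i$, and $\widehat\vartheta^{\mathrm{MLE}}=\int_0^1\widehat f^{\mathrm{MLE}}$. $\Phi$ is the standard normal distribution function; $\mathcal{N}(\mu,\sigma^2)$ has mean $\mu$ and variance $\sigma^2$; $\|P-Q\|_{\mathrm{TV}}=\sup_B|P(B)-Q(B)|$;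 $\wedge$ denotes minimum. "Asymptotic $(1-\alpha)$-credible set" means $E_{f_0}[\Pi(\vartheta\in I(\alpha)\mid N)]\to1-\alpha$. All limits are as $n\to\infty$. *)

theory Defs
  imports "HOL-Probability.Probability" "HOL-Library.Landau_Symbols"
begin

section \<open>Poisson point processes\<close>

text \<open>
  A random measure \<open>N\<close> on the probability space \<open>M\<close> is a Poisson point process with intensity
  \<open>\<mu>\<close> if \<open>N(B)\<close> is Poisson distributed with mean \<open>\<mu>(B)\<close> whenever that is finite, and counts of
  pairwise disjoint sets are independent. For \<open>\<mu>\<close> sigma-finite, \<open>N(B) = \<infinity>\<close> almost surely when
  \<open>\<mu>(B) = \<infinity>\<close> is a consequence.
\<close>

definition poisson_point_process :: "'w measure \<Rightarrow> 'a measure \<Rightarrow> ('w \<Rightarrow> 'a measure) \<Rightarrow> bool" where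
  "poisson_point_process M \<mu> N \<longleftrightarrow>
     prob_space M \<and>
     (\<forall>\<omega>\<in>space M. sets (N \<omega>) = sets \<mu>) \<and>
     (\<forall>B\<in>sets \<mu>. (\<lambda>\<omega>. emeasure (N \<omega>) B) \<in> borel_measurable M) \<and>
     (\<forall>B\<in>sets \<mu>. emeasure \<mu> B < \<infinity> \<longrightarrow>
        (\<forall>k::nat. measure M {\<omega>\<in>space M. emeasure (N \<omega>) B = of_nat k}
                 = exp (- measure \<mu> B) * measure \<mu> B ^ k / fact k)) \<and>
     (\<forall>(I::nat set) B. finite I \<longrightarrow> B ` I \<subseteq> sets \<mu> \<longrightarrow> disjoint_family_on B I \<longrightarrow>
        prob_space.indep_vars M (\<lambda>_. borel) (\<lambda>i \<omega>. emeasure (N \<omega>) (B i)) I)"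

text \<open>The point measure \<open>\<Sum>\<^sub>i \<delta>(x\<^sub>i, y\<^sub>i)\<close>, as an image of counting measure on the indices.\<close>

definition point_measure_of :: "(nat \<Rightarrow> real) \<Rightarrow> (nat \<Rightarrow> real) \<Rightarrow> (real \<times> real) measure" where
  "point_measure_of xs ys = distr (count_space UNIV) borel (\<lambda>i. (xs i, ys i))"

lemma emeasure_point_measure_of:
  assumes "B \<in> sets borel"
  shows "emeasure (point_measure_of xs ys) B = emeasure (count_space UNIV) {i. (xs i, ys i) \<in> B}"
  using assms by (simp add: point_measure_of_def emeasure_distr vimage_def)

definition intensity :: "nat \<Rightarrow> (real \<Rightarrow> real) \<Rightarrow> (real \<times> real) measure" where
  "intensity n f =
     density lborel (\<lambda>z. ennreal (real n) * indicator {(x, y). x \<in> {0..1} \<and> f x \<le> y} z)"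

text \<open>
  \<open>X\<close>, \<open>Y\<close> realise an observation with law \<open>P\<^sub>f\<close> on the probability space \<open>M\<close>. The total intensity is
  infinite for \<open>n \<ge> 1\<close>, so there are almost surely infinitely many points and they can be
  enumerated by the natural numbers; no such realisation exists for \<open>n = 0\<close>.
\<close>

definition boundary_model ::
  "'w measure \<Rightarrow> nat \<Rightarrow> (real \<Rightarrow> real) \<Rightarrow> (nat \<Rightarrow> 'w \<Rightarrow> real) \<Rightarrow> (nat \<Rightarrow> 'w \<Rightarrow> real) \<Rightarrow> bool" where
  "boundary_model M n f X Y \<longleftrightarrow>
     (\<forall>i. X i \<in> borel_measurable M) \<and> (\<forall>i. Y i \<in> borel_measurable M) \<and>
     poisson_point_process M (intensity n f) (\<lambda>\<omega>. point_measure_of (\<lambda>i. X i \<omega>) (\<lambda>i. Y i \<omega>))"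

section \<open>Piecewise constant functions, prior and posterior\<close>

definition bin :: "nat \<Rightarrow> nat \<Rightarrow> real set" where
  "bin K j = {(real j - 1) / real K ..< real j / real K}"

definition step_fun :: "nat \<Rightarrow> (nat \<Rightarrow> real) \<Rightarrow> real \<Rightarrow> real" where
  "step_fun K a x = (\<Sum>j=1..K. a j * indicator (bin K j) x)"

definition theta :: "(real \<Rightarrow> real) \<Rightarrow> real" where
  "theta f = (LINT x:{0..1}|lborel. f x)"

text \<open>The vectors \<open>(a\<^sub>1, \<dots>, a\<^sub>K)\<close> are functions on \<open>{1..K}\<close>, with Lebesgue measure the product measure.\<close>

definition param_space :: "nat \<Rightarrow> (nat \<Rightarrow> real) measure" where
  "param_space K = (\<Pi>\<^sub>M j\<in>{1..K}. lborel)"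

definition prior_g :: "real \<Rightarrow> real \<Rightarrow> real" where
  "prior_g R x = indicator {-R..R} x / (2 * R)"

definition posterior_weight ::
  "nat \<Rightarrow> nat \<Rightarrow> real \<Rightarrow> (nat \<Rightarrow> real) \<Rightarrow> (nat \<Rightarrow> real) \<Rightarrow> (nat \<Rightarrow> real) \<Rightarrow> real" where
  "posterior_weight n K R xs ys a =
     exp (real n * theta (step_fun K a)) *
     (if \<forall>i. step_fun K a (xs i) \<le> ys i then 1 else 0) *
     (\<Prod>j=1..K. prior_g R (a j))"

definition posterior ::
  "nat \<Rightarrow> nat \<Rightarrow> real \<Rightarrow> (nat \<Rightarrow> real) \<Rightarrow> (nat \<Rightarrow> real) \<Rightarrow> (nat \<Rightarrow> real) measure" where
  "posterior n K R xs ys =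
     density (param_space K)
       (\<lambda>a. ennreal (posterior_weight n K R xs ys a)
            / (\<integral>\<^sup>+ b. ennreal (posterior_weight n K R xs ys b) \<partial>param_space K))"

definition posterior_theta ::
  "nat \<Rightarrow> nat \<Rightarrow> real \<Rightarrow> (nat \<Rightarrow> real) \<Rightarrow> (nat \<Rightarrow> real) \<Rightarrow> real measure" where
  "posterior_theta n K R xs ys = distr (posterior n K R xs ys) borel (\<lambda>a. theta (step_fun K a))"

section \<open>Maximum likelihood, normal approximation and credible interval\<close>

text \<open>
  Under the model the infimum is almost surely attained. Samples for which a bin contains no points,
  or points with \<open>y\<close>-values unbounded below, have probability zero.
\<close>

definition mle_coeff :: "nat \<Rightarrow> (nat \<Rightarrow> real) \<Rightarrow> (nat \<Rightarrow> real) \<Rightarrow> nat \<Rightarrow> real" where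
  "mle_coeff K xs ys j = (INF i\<in>{i. xs i \<in> bin K j}. ys i)"

definition theta_mle :: "nat \<Rightarrow> (nat \<Rightarrow> real) \<Rightarrow> (nat \<Rightarrow> real) \<Rightarrow> real" where
  "theta_mle K xs ys = theta (step_fun K (mle_coeff K xs ys))"

text \<open>The normal law by mean and variance; \<^const>\<open>normal_density\<close> takes the standard deviation.\<close>

definition normal_law :: "real \<Rightarrow> real \<Rightarrow> real measure" where
  "normal_law m v = density lborel (\<lambda>x. ennreal (normal_density m (sqrt v) x))"

definition tv_dist :: "'a measure \<Rightarrow> 'a measure \<Rightarrow> real" where
  "tv_dist P Q = (SUP B\<in>sets P. \<bar>measure P B - measure Q B\<bar>)"

text \<open>The normal distribution function is injective, so on \<open>{0<..<1}\<close> this is the quantile function.\<close>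

definition normal_quantile :: "real \<Rightarrow> real" where
  "normal_quantile = inv (cdf std_normal_distribution)"

definition credible_interval ::
  "nat \<Rightarrow> nat \<Rightarrow> (nat \<Rightarrow> real) \<Rightarrow> (nat \<Rightarrow> real) \<Rightarrow> real \<Rightarrow> real set" where
  "credible_interval n K xs ys \<alpha> =
     {theta_mle K xs ys - real K / real n + sqrt (real K) / real n * normal_quantile (\<alpha> / 2) ..
      theta_mle K xs ys - real K / real n + sqrt (real K) / real n * normal_quantile (1 - \<alpha> / 2)}"

definition rho :: "nat \<Rightarrow> nat \<Rightarrow> real" where
  "rho n K = 1 / 2 ^ 8 * min (real n * real K powr (-3/2)) (real n ^ 2 * real K powr (-7/2))"

end

theory Submission
  imports Defs "HOL-Real_Asymp.Real_Asymp"
begin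

text \<open>
  Given the bin minima \<open>h\<^sub>j\<close>, the posterior makes the differences \<open>h\<^sub>j - a\<^sub>j\<close> independent
  exponential variables of rate \<open>n / K\<close>, up to the truncation at \<open>- R\<close>, whose effect is exponentially
  small. Hence \<open>n (\<theta>\<^sub>M\<^sub>L\<^sub>E - \<theta>)\<close> is nearly Gamma(\<open>K\<close>) distributed, and the standardized Gamma density tends
  to the normal density in \<open>L\<^sup>1\<close>.

  For the frequentist claim, let \<open>D\<^sub>j\<close> be the height of \<open>h\<^sub>j\<close> above the left end of bin \<open>j\<close>. The area
  \<open>A(D\<^sub>j)\<close> between the boundary and the level \<open>h\<^sub>j\<close> makes \<open>T\<^sub>j = n A(D\<^sub>j)\<close> standard exponential, and
  \<open>D\<^sub>j - 1/(2K) = (K/n) T\<^sub>j - (K/2) (1/K - D\<^sub>j)\<^sub>+\<^sup>2\<close>. The last term is at least \<open>1/(8K)\<close> whenever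
  \<open>D\<^sub>j < 1/(2K)\<close>. By Chernoff's bound this happens for sufficiently many \<open>j\<close> to create a negative bias of
  order \<open>min (1/K) (n/K\<^sup>3)\<close>, while the fluctuations of \<open>\<Sum> T\<^sub>j\<close> are negligible for \<open>K = o(n powr (4/7))\<close>
  by Chebyshev's inequality.
\<close>

section \<open>Normal approximation of the Gamma density\<close>

text \<open>The frequentist part is a race between bias and noise. With
  \<open>v = min 1 (n / K^2)\<close>, a bin minimum lies within \<open>1 / (2 K)\<close> of the left
  boundary value with probability at least \<open>v / 10\<close>. This produces a bias of order
  \<open>v / K\<close>, whereas the waiting times move the estimator by about
  \<open>sqrt K / n\<close>. The quotient of the two orders is \<open>n v K powr (-3/2)\<close>,
  which is \<open>rho\<close> up to the factor \<open>1 / 2 ^ 8\<close>. The bias dominates once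
  \<open>K^3 / (n v)^2\<close> vanishes, for which it suffices that \<open>K^3 / n^2\<close> and
  \<open>K^7 / n^4\<close> do; the second term is the origin of the exponent 4/7. The exact
  factorization of the posterior requires all minima to lie below \<open>R\<close>, since only then
  is the upper end of the prior support invisible. The exceptional event has probability at most
  \<open>K exp (- (n / K) (R - 1))\<close>, and \<open>K ln n \<le> n\<close> turns this into at
  most \<open>1 / n\<close> when \<open>R - 1 > 2\<close>; this is the use of \<open>R > 3\<close>.
  The total variation distance is a supremum over all Borel sets, so its expectation is controlled
  by a deterministic bound off a measurable bad event instead of by its measurability.\<close>

lemma ln_one_plus_le_minus_square:
  fixes w :: real
  assumes "-1 < w"
  shows "ln (1 + w) - w \<le> - (w\<^sup>2 / (2 * (1 + max 0 w)))"
proof -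
  define h where "h = (\<lambda>w::real. ln (1 + w) - w + w\<^sup>2 / (2 * (1 + max 0 w)))"
  have "h w \<le> 0"
  proof (cases "w \<ge> 0")
    case True
    \<comment> \<open>With \<open>y = 1 + w\<close> the claim reads
      \<open>ln y \<le> (y - 1 / y) / 2\<close>, and the difference \<open>k\<close> has derivative
      \<open>- (1 - 1 / y)^2 / 2\<close>.\<close>
    define k where "k = (\<lambda>w::real. ln (1 + w) - w / 2 - 1 / 2 + 1 / (2 * (1 + w)))"
    have "k w \<le> k 0"
    proof (rule DERIV_nonpos_imp_nonincreasing[OF True])
      fix x :: real assume x: "0 \<le> x" "x \<le> w"
      have "(k has_real_derivative (1 / (1 + x) - 1 / 2 - 2 / (2 * (1 + x))\<^sup>2)) (at x)"
        unfolding k_def using x by (auto intro!: derivative_eq_intros simp: power2_eq_square)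
      also have "1 / (1 + x) - 1 / 2 - 2 / (2 * (1 + x))\<^sup>2 = - ((1 - 1 / (1 + x))\<^sup>2 / 2)"
        using x by (simp add: divide_simps power2_eq_square) (simp add: algebra_simps)
      finally show "\<exists>y. (k has_real_derivative y) (at x) \<and> y \<le> 0"
        by (intro exI[of _ "- ((1 - 1 / (1 + x))\<^sup>2 / 2)"]) auto
    qed
    moreover have "h w = k w"
      using True by (simp add: h_def k_def max_def field_simps power2_eq_square)
    ultimately show ?thesis by (simp add: k_def)
  next
    case False
    define k where "k = (\<lambda>w::real. ln (1 + w) - w + w\<^sup>2 / 2)"
    have "k w \<le> k 0"
    proof (rule DERIV_nonneg_imp_nondecreasing[of w 0 k])
      show "w \<le> 0" using False by simp
    next
      fix x :: real assume x: "w \<le> x" "x \<le> 0"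
      have "(k has_real_derivative (1 / (1 + x) - 1 + x)) (at x)"
        unfolding k_def using x assms by (auto intro!: derivative_eq_intros)
      also have "1 / (1 + x) - 1 + x = x\<^sup>2 / (1 + x)"
        using x assms by (simp add: field_simps power2_eq_square)
      finally show "\<exists>y. (k has_real_derivative y) (at x) \<and> y \<ge> 0"
        using x assms by (intro exI[of _ "x\<^sup>2 / (1 + x)"]) auto
    qed
    thus ?thesis using False by (simp add: h_def k_def max_def)
  qed
  thus ?thesis by (simp add: h_def)
qed

text \<open>The density of a standardized Gamma(\<open>K\<close>) variable without its normalizing
  constant, scaled to the value 1 at \<open>z = 0\<close>.\<close>

definition gamma_kernel :: "nat \<Rightarrow> real \<Rightarrow> real" where
  "gamma_kernel K z =
     (if z < - sqrt K then 0 else (1 + z / sqrt K) ^ (K - 1) * exp (- (sqrt K * z)))"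

lemma erlang_density_eq_gamma_kernel:
  assumes "K > 0"
  shows "sqrt K * erlang_density (K - 1) 1 (real K + sqrt K * z)
    = sqrt K * real K ^ (K - 1) * exp (- real K) / fact (K - 1) * gamma_kernel K z"
proof -
  have K: "real K = sqrt K * sqrt K" by simp
  have neg: "real K + sqrt K * z < 0 \<longleftrightarrow> z < - sqrt K"
  proof -
    have "real K + sqrt K * z = sqrt K * (sqrt K + z)" by (simp add: distrib_left)
    also have "\<dots> < 0 \<longleftrightarrow> sqrt K + z < 0"
      using assms by (simp add: mult_less_0_iff)
    finally show ?thesis by linarith
  qed
  have "real K + sqrt K * z = real K * (1 + z / sqrt K)"
  proof -
    have "real K * (z / sqrt K) = (real K / sqrt K) * z" by simp
    also have "real K / sqrt K = sqrt K" by (rule real_div_sqrt) simp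
    finally show ?thesis by (simp add: distrib_left)
  qed
  hence "(real K + sqrt K * z) ^ (K - 1) = real K ^ (K - 1) * (1 + z / sqrt K) ^ (K - 1)"
    by (simp add: power_mult_distrib)
  thus ?thesis
    unfolding erlang_density_def gamma_kernel_def neg
    by (simp add: exp_diff exp_minus field_simps)
qed

text \<open>Integrable majorant for dominated convergence. With \<open>w = z / sqrt K\<close> the
  logarithm of the kernel is \<open>(K - 1) (ln (1 + w) - w) - w\<close>, and
  \<open>K \<ge> 2\<close> gives \<open>K - 1 \<ge> K / 2\<close>. The decay is Gaussian on the left
  but only exponential on the right, so a two-sided exponential is the common bound.\<close>

lemma gamma_kernel_le:
  assumes "K \<ge> 2"
  shows "gamma_kernel K z \<le> exp (2 - \<bar>z\<bar> / 4)"
proof (cases "z \<le> - sqrt K")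
  case True
  hence "gamma_kernel K z = 0"
    using assms by (cases "z = - sqrt K") (auto simp: gamma_kernel_def)
  thus ?thesis by simp
next
  case False
  define w where "w = z / sqrt K"
  have K: "sqrt K > 0" "sqrt K \<ge> 1" "real K \<ge> 2" using assms by auto
  have w: "-1 < w" using False K by (simp add: w_def field_simps)
  have z: "z = sqrt K * w" using K by (simp add: w_def)
  have zz: "z\<^sup>2 = real K * w\<^sup>2" by (simp add: z power_mult_distrib)
  have sz: "sqrt K * z = real K * w" by (simp add: z)
  have ex: "(1 + w) ^ (K - 1) = exp ((real K - 1) * ln (1 + w))"
  proof -
    have "exp ((real K - 1) * ln (1 + w)) = exp (real (K - 1) * ln (1 + w))"
      using assms by (simp add: of_nat_diff)
    also have "\<dots> = exp (ln (1 + w)) ^ (K - 1)" by (rule exp_of_nat_mult)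
    finally show ?thesis using w by simp
  qed
  have "(real K - 1) * ln (1 + w) - real K * w = (real K - 1) * (ln (1 + w) - w) - w"
    by (simp add: algebra_simps)
  also have "\<dots> \<le> (real K - 1) * (- (w\<^sup>2 / (2 * (1 + max 0 w)))) - w"
    using ln_one_plus_le_minus_square[OF w] K by (intro diff_right_mono mult_left_mono) auto
  also have "\<dots> \<le> real K / 2 * (- (w\<^sup>2 / (2 * (1 + max 0 w)))) - w"
  proof -
    have "real K / 2 * (w\<^sup>2 / (2 * (1 + max 0 w))) \<le> (real K - 1) * (w\<^sup>2 / (2 * (1 + max 0 w)))"
      using K by (intro mult_right_mono) auto
    thus ?thesis by simp
  qed
  also have "\<dots> = - (z\<^sup>2 / (4 * (1 + max 0 w))) - w"
    by (simp add: zz)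
  also have "\<dots> \<le> 2 - \<bar>z\<bar> / 4"
  proof (cases "z \<ge> 0")
    case True
    hence w0: "w \<ge> 0" "w \<le> z" using K by (auto simp: w_def field_simps mult_le_cancel_left1)
    have "(z - 1) / 4 \<le> z\<^sup>2 / (4 * (1 + z))"
      using True by (simp add: field_simps power2_eq_square)
    also have "\<dots> \<le> z\<^sup>2 / (4 * (1 + w))"
      using w0 True by (intro divide_left_mono) auto
    finally show ?thesis using w0 True by (simp add: max_def)
  next
    case False
    hence w0: "w < 0" "- w \<le> - z" using K by (auto simp: w_def field_simps)
    \<comment> \<open>Completing the square in \<open>z^2 / 4 + 5 z / 4\<close>; the constant 2 of
      the majorant covers the remainder 25/16.\<close>
    have "0 \<le> (z / 2 + 5 / 4)\<^sup>2" by simp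
    also have "\<dots> = z\<^sup>2 / 4 + 5 / 4 * z + 25 / 16" by (simp add: power2_eq_square algebra_simps)
    finally show ?thesis using w0 False by (simp add: max_def)
  qed
  finally have "(real K - 1) * ln (1 + w) - real K * w \<le> 2 - \<bar>z\<bar> / 4" .
  moreover have "gamma_kernel K z = exp ((real K - 1) * ln (1 + w) - real K * w)"
  proof -
    have "gamma_kernel K z = (1 + w) ^ (K - 1) * exp (- (real K * w))"
      using False unfolding sz[symmetric] by (simp add: gamma_kernel_def w_def)
    also have "\<dots> = exp ((real K - 1) * ln (1 + w) - real K * w)"
      unfolding ex exp_add[symmetric] by simp
    finally show ?thesis .
  qed
  ultimately show ?thesis by simp
qed

text \<open>The second-order term of \<open>ln (1 + z / sqrt K)\<close> gives the limit of the
  exponent. The power may be written through the logarithm as soon as \<open>sqrt K\<close> exceeds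
  the absolute value of \<open>z\<close>.\<close>

lemma gamma_kernel_tendsto: "(\<lambda>K. gamma_kernel K z) \<longlonglongrightarrow> exp (- (z\<^sup>2 / 2))"
proof -
  have "((\<lambda>x::real. (x - 1) * ln (1 + z / sqrt x) - sqrt x * z) \<longlongrightarrow> - (z\<^sup>2 / 2)) at_top"
    by (cases z "0::real" rule: linorder_cases) (real_asymp simp: power2_eq_square)+
  hence "(\<lambda>K. (real K - 1) * ln (1 + z / sqrt K) - sqrt K * z) \<longlonglongrightarrow> - (z\<^sup>2 / 2)"
    by (rule filterlim_compose[OF _ filterlim_real_sequentially])
  hence "(\<lambda>K. exp ((real K - 1) * ln (1 + z / sqrt K) - sqrt K * z)) \<longlonglongrightarrow> exp (- (z\<^sup>2 / 2))"
    by (rule tendsto_exp)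
  moreover have "\<forall>\<^sub>F K in sequentially. exp ((real K - 1) * ln (1 + z / sqrt K) - sqrt K * z) = gamma_kernel K z"
  proof -
    have "filterlim (\<lambda>K. sqrt (real K)) at_top sequentially" by real_asymp
    hence "\<forall>\<^sub>F K in sequentially. \<bar>z\<bar> < sqrt (real K)" by (simp add: filterlim_at_top_dense)
    thus ?thesis using eventually_ge_at_top[of 1]
    proof eventually_elim
      case (elim K)
      hence p: "0 < 1 + z / sqrt K" by (simp add: field_simps)
      have "exp ((real K - 1) * ln (1 + z / sqrt K)) = (1 + z / sqrt K) ^ (K - 1)"
      proof -
        have "exp ((real K - 1) * ln (1 + z / sqrt K)) = exp (real (K - 1) * ln (1 + z / sqrt K))"
          using elim by (simp add: of_nat_diff)
        also have "\<dots> = exp (ln (1 + z / sqrt K)) ^ (K - 1)" by (rule exp_of_nat_mult)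
        finally show ?thesis using p by simp
      qed
      hence "exp ((real K - 1) * ln (1 + z / sqrt K) - sqrt K * z) = (1 + z / sqrt K) ^ (K - 1) * exp (- (sqrt K * z))"
        by (simp add: exp_diff exp_minus divide_inverse)
      thus ?case using elim by (simp add: gamma_kernel_def)
    qed
  qed
  ultimately show ?thesis by (rule Lim_transform_eventually)
qed

lemma gamma_kernel_measurable[measurable]: "gamma_kernel K \<in> borel_measurable borel"
  unfolding gamma_kernel_def[abs_def] by measurable

lemma gamma_kernel_nonneg: "gamma_kernel K z \<ge> 0"
  by (cases "K = 0") (auto simp: gamma_kernel_def field_simps not_less intro!: mult_nonneg_nonneg zero_le_power)

text \<open>Dominated by a multiple of an exponential density of rate 1/4 plus its reflection. At 0
  both contribute, hence an inequality.\<close>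

lemma integrable_exp_minus_abs: "integrable lborel (\<lambda>z::real. exp (2 - \<bar>z\<bar> / 4))"
proof -
  interpret prob_space "density lborel (exponential_density (1/4))"
    by (rule prob_space_exponential_density) simp
  have e: "integrable lborel (exponential_density (1/4))"
    using emeasure_space_1 by (intro integrableI_nonneg) (auto simp: emeasure_density)
  hence e': "integrable lborel (\<lambda>z. exponential_density (1/4) (0 + (-1) * z))"
    by (subst lborel_integrable_real_affine_iff) auto
  show ?thesis
  proof (rule Bochner_Integration.integrable_bound)
    show "integrable lborel (\<lambda>z. 4 * exp 2 * (exponential_density (1/4) z + exponential_density (1/4) (0 + (-1) * z)))"
      using e e' by (intro integrable_mult_right Bochner_Integration.integrable_add)
    show "AE z in lborel. norm (exp (2 - \<bar>z\<bar> / 4)) \<le>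
        norm (4 * exp 2 * (exponential_density (1/4) z + exponential_density (1/4) (0 + (-1) * z)))"
    proof (intro AE_I2)
      fix z :: real
      have "exp (- \<bar>z\<bar> / 4) \<le> 4 * (exponential_density (1/4) z + exponential_density (1/4) (- z))"
        by (cases "z \<ge> 0") (auto simp: exponential_density_def)
      hence "exp 2 * exp (- \<bar>z\<bar> / 4) \<le> exp 2 * (4 * (exponential_density (1/4) z + exponential_density (1/4) (- z)))"
        by (intro mult_left_mono) auto
      also have "exp 2 * exp (- \<bar>z\<bar> / 4) = exp (2 - \<bar>z\<bar> / 4)"
        unfolding exp_add[symmetric] by simp
      finally show "norm (exp (2 - \<bar>z\<bar> / 4)) \<le>
        norm (4 * exp 2 * (exponential_density (1/4) z + exponential_density (1/4) (0 + (-1) * z)))"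
        by (simp add: algebra_simps)
    qed
  qed simp
qed

lemma integrable_gamma_kernel: "K \<ge> 2 \<Longrightarrow> integrable lborel (gamma_kernel K)"
  by (rule Bochner_Integration.integrable_bound[OF integrable_exp_minus_abs])
     (auto simp: gamma_kernel_nonneg gamma_kernel_le)

text \<open>For \<open>K > 0\<close>, twice the total variation distance between the standardized
  Gamma(\<open>K\<close>) law and the standard normal law. It depends on \<open>K\<close> alone,
  which makes the posterior bound uniform over the data.\<close>

definition normal_approx_error :: "nat \<Rightarrow> real" where
  "normal_approx_error K =
     (LINT z|lborel. \<bar>sqrt K * erlang_density (K - 1) 1 (real K + sqrt K * z) - std_normal_density z\<bar>)"

lemma integral_erlang_standardized:
  assumes "K > 0"
  shows "(LINT z|lborel. sqrt K * erlang_density (K - 1) 1 (real K + sqrt K * z)) = 1"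
    and "integrable lborel (\<lambda>z. sqrt K * erlang_density (K - 1) 1 (real K + sqrt K * z))"
proof -
  interpret prob_space "density lborel (erlang_density (K - 1) 1)"
    by (rule prob_space_erlang_density) simp
  have 1: "(\<integral>\<^sup>+x. erlang_density (K - 1) 1 x \<partial>lborel) = 1"
    using emeasure_space_1 by (simp add: emeasure_density)
  have i: "integrable lborel (erlang_density (K - 1) 1)"
    using 1 by (intro integrableI_nonneg) auto
  have "(LINT x|lborel. erlang_density (K - 1) 1 x) = 1"
    using 1 by (subst integral_eq_nn_integral) auto
  thus "(LINT z|lborel. sqrt K * erlang_density (K - 1) 1 (real K + sqrt K * z)) = 1"
    using assms lborel_integral_real_affine[of "sqrt K" "erlang_density (K - 1) 1" "real K"] by simp
  show "integrable lborel (\<lambda>z. sqrt K * erlang_density (K - 1) 1 (real K + sqrt K * z))"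
    using assms i by (intro integrable_mult_right) (subst lborel_integrable_real_affine_iff, auto)
qed

text \<open>Scheffe's argument. The normalizing constants converge because the kernels integrate to
  \<open>\<surd>(2\<pi>)\<close> in the limit, which makes Stirling's formula unnecessary.\<close>

lemma normal_approx_error_tendsto_0: "normal_approx_error \<longlonglongrightarrow> 0"
proof -
  define c where "c = (\<lambda>K. sqrt (real K) * real K ^ (K - 1) * exp (- real K) / fact (K - 1))"
  define g where "g = (\<lambda>z::real. exp (- (z\<^sup>2 / 2)))"
  define J where "J = (\<lambda>K. LINT z|lborel. gamma_kernel K z)"
  have std: "std_normal_density z = 1 / sqrt (2 * pi) * g z" for z
    by (simp add: std_normal_density_def g_def)
  have int_std: "(LINT z|lborel. std_normal_density z) = 1" "integrable lborel std_normal_density"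
    by (simp_all add: integral_normal_density integrable_normal_density)
  moreover have "g = (\<lambda>z. sqrt (2 * pi) * std_normal_density z)"
    by (simp add: std fun_eq_iff)
  ultimately have int_g: "(LINT z|lborel. g z) = sqrt (2 * pi)" "integrable lborel g"
    by simp_all
  have gm[measurable]: "g \<in> borel_measurable borel" unfolding g_def by measurable
  \<comment> \<open>The shift by 2 is due to the majorant, which is available for
    \<open>K \<ge> 2\<close>; \<open>LIMSEQ_offset\<close> removes it below.\<close>
  have lim: "(\<lambda>k. LINT z|lborel. gamma_kernel (k + 2) z) \<longlonglongrightarrow> (LINT z|lborel. g z)"
    using gamma_kernel_le[of "k + 2" for k] LIMSEQ_ignore_initial_segment[OF gamma_kernel_tendsto, where k=2]
    by (intro integral_dominated_convergence[where w="\<lambda>z. exp (2 - \<bar>z\<bar> / 4)"])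
       (auto simp: integrable_exp_minus_abs gamma_kernel_nonneg g_def)
  have lim': "(\<lambda>k. LINT z|lborel. \<bar>gamma_kernel (k + 2) z - g z\<bar>) \<longlonglongrightarrow> (LINT z|(lborel::real measure). 0)"
  proof (rule integral_dominated_convergence[where w="\<lambda>z. exp (2 - \<bar>z\<bar> / 4) + g z"])
    show "integrable lborel (\<lambda>z. exp (2 - \<bar>z\<bar> / 4) + g z)"
      using integrable_exp_minus_abs int_g by auto
    show "AE z in lborel. (\<lambda>k. \<bar>gamma_kernel (k + 2) z - g z\<bar>) \<longlonglongrightarrow> 0"
    proof (intro AE_I2)
      fix z
      have "(\<lambda>k. gamma_kernel (k + 2) z - g z) \<longlonglongrightarrow> 0"
        using LIMSEQ_ignore_initial_segment[OF gamma_kernel_tendsto[of z], where k=2]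
        by (subst LIM_zero_iff) (simp add: g_def)
      thus "(\<lambda>k. \<bar>gamma_kernel (k + 2) z - g z\<bar>) \<longlonglongrightarrow> 0" by (rule tendsto_rabs_zero)
    qed
    show "AE z in lborel. norm \<bar>gamma_kernel (k + 2) z - g z\<bar> \<le> exp (2 - \<bar>z\<bar> / 4) + g z" for k
    proof (intro AE_I2)
      fix z
      have "gamma_kernel (k + 2) z \<le> exp (2 - \<bar>z\<bar> / 4)" by (rule gamma_kernel_le) simp
      moreover have "gamma_kernel (k + 2) z \<ge> 0" by (rule gamma_kernel_nonneg)
      moreover have "g z \<ge> 0" by (simp add: g_def)
      ultimately show "norm \<bar>gamma_kernel (k + 2) z - g z\<bar> \<le> exp (2 - \<bar>z\<bar> / 4) + g z" by auto
    qed
  qed auto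
  have J: "J \<longlonglongrightarrow> sqrt (2 * pi)" using LIMSEQ_offset[of J 2] lim int_g by (simp add: J_def)
  have L: "(\<lambda>K. LINT z|lborel. \<bar>gamma_kernel K z - g z\<bar>) \<longlonglongrightarrow> 0"
    using LIMSEQ_offset[of "\<lambda>K. LINT z|lborel. \<bar>gamma_kernel K z - g z\<bar>" 2] lim' by simp
  have cJ: "c K * J K = 1" if "K > 0" for K
  proof -
    have "c K * J K = (LINT z|lborel. c K * gamma_kernel K z)" by (simp add: J_def)
    also have "\<dots> = (LINT z|lborel. sqrt K * erlang_density (K - 1) 1 (real K + sqrt K * z))"
      unfolding c_def erlang_density_eq_gamma_kernel[OF that] ..
    finally show ?thesis using integral_erlang_standardized(1)[OF that] by simp
  qed
  have c: "c \<longlonglongrightarrow> 1 / sqrt (2 * pi)"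
  proof (rule Lim_transform_eventually)
    show "(\<lambda>K. 1 / J K) \<longlonglongrightarrow> 1 / sqrt (2 * pi)"
      using J by (intro tendsto_divide) auto
    show "\<forall>\<^sub>F K in sequentially. 1 / J K = c K"
      using eventually_gt_at_top[of 0]
    proof eventually_elim
      case (elim K) thus ?case using cJ[of K] by (metis nonzero_eq_divide_eq mult_zero_right zero_neq_one)
    qed
  qed
  \<comment> \<open>The error of the normalizing constant is separated from the error of the kernel,
    so that both limits above apply.\<close>
  have bound: "normal_approx_error K \<le>
      \<bar>c K - 1 / sqrt (2 * pi)\<bar> * J K + 1 / sqrt (2 * pi) * (LINT z|lborel. \<bar>gamma_kernel K z - g z\<bar>)"
    if K: "K \<ge> 2" for K
  proof -
    have i: "integrable lborel (gamma_kernel K)" by (rule integrable_gamma_kernel[OF K])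
    have "normal_approx_error K = (LINT z|lborel. \<bar>c K * gamma_kernel K z - 1 / sqrt (2 * pi) * g z\<bar>)"
      using K unfolding normal_approx_error_def std
      by (subst erlang_density_eq_gamma_kernel) (auto simp: c_def)
    also have "\<dots> \<le> (LINT z|lborel. \<bar>c K - 1 / sqrt (2 * pi)\<bar> * gamma_kernel K z
          + 1 / sqrt (2 * pi) * \<bar>gamma_kernel K z - g z\<bar>)"
    proof (rule integral_mono)
      fix z
      have "c K * gamma_kernel K z - 1 / sqrt (2 * pi) * g z =
        (c K - 1 / sqrt (2 * pi)) * gamma_kernel K z + 1 / sqrt (2 * pi) * (gamma_kernel K z - g z)"
        by (simp add: left_diff_distrib diff_divide_distrib)
      also have "\<bar>\<dots>\<bar> \<le> \<bar>(c K - 1 / sqrt (2 * pi)) * gamma_kernel K z\<bar> + \<bar>1 / sqrt (2 * pi) * (gamma_kernel K z - g z)\<bar>"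
        by (rule abs_triangle_ineq)
      finally show "\<bar>c K * gamma_kernel K z - 1 / sqrt (2 * pi) * g z\<bar> \<le>
        \<bar>c K - 1 / sqrt (2 * pi)\<bar> * gamma_kernel K z + 1 / sqrt (2 * pi) * \<bar>gamma_kernel K z - g z\<bar>"
        by (simp add: abs_mult gamma_kernel_nonneg)
    qed (use i int_g in auto)
    also have "\<dots> = \<bar>c K - 1 / sqrt (2 * pi)\<bar> * J K + 1 / sqrt (2 * pi) * (LINT z|lborel. \<bar>gamma_kernel K z - g z\<bar>)"
      using i int_g by (subst Bochner_Integration.integral_add) (auto simp: J_def)
    finally show ?thesis .
  qed
  show ?thesis
  proof (rule tendsto_sandwich[OF _ _ tendsto_const])
    show "\<forall>\<^sub>F K in sequentially. 0 \<le> normal_approx_error K"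
      by (simp add: normal_approx_error_def)
    show "\<forall>\<^sub>F K in sequentially. normal_approx_error K \<le>
      \<bar>c K - 1 / sqrt (2 * pi)\<bar> * J K + 1 / sqrt (2 * pi) * (LINT z|lborel. \<bar>gamma_kernel K z - g z\<bar>)"
      using eventually_ge_at_top[of 2] by eventually_elim (rule bound)
    have "(\<lambda>K. \<bar>c K - 1 / sqrt (2 * pi)\<bar>) \<longlonglongrightarrow> 0"
      using c by (intro tendsto_rabs_zero) (simp add: LIM_zero_iff)
    hence "(\<lambda>K. \<bar>c K - 1 / sqrt (2 * pi)\<bar> * J K + 1 / sqrt (2 * pi) * (LINT z|lborel. \<bar>gamma_kernel K z - g z\<bar>))
      \<longlonglongrightarrow> 0 * sqrt (2 * pi) + 1 / sqrt (2 * pi) * 0"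
      by (intro tendsto_intros J L)
    thus "(\<lambda>K. \<bar>c K - 1 / sqrt (2 * pi)\<bar> * J K + 1 / sqrt (2 * pi) * (LINT z|lborel. \<bar>gamma_kernel K z - g z\<bar>))
      \<longlonglongrightarrow> 0" by simp
  qed
qed

section \<open>The posterior given the bin minima\<close>

lemma sets_bin[measurable]: "bin K j \<in> sets borel"
  by (simp add: bin_def)

lemma bin_subset: "j \<in> {1..K} \<Longrightarrow> x \<in> bin K j \<Longrightarrow> 0 \<le> x \<and> x < 1"
proof -
  assume j: "j \<in> {1..K}" and "x \<in> bin K j"
  hence x: "(real j - 1) / real K \<le> x" "x < real j / real K" by (auto simp: bin_def)
  have "0 \<le> (real j - 1) / real K" "real j / real K \<le> 1" using j by auto
  thus "0 \<le> x \<and> x < 1" using x by auto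
qed

lemma theta_step_fun:
  assumes "K > 0"
  shows "theta (step_fun K a) = (\<Sum>j=1..K. a j) / real K"
proof -
  have sub: "bin K j \<subseteq> {0..1}" if "j \<in> {1..K}" for j
    using bin_subset[OF that] by fastforce
  have meas: "measure lborel (bin K j) = 1 / real K" for j
    using assms by (simp add: bin_def divide_right_mono diff_divide_distrib)
  have fin: "emeasure lborel (bin K j) < \<infinity>" for j
    using emeasure_lborel_Ico[of "(real j - 1) / real K" "real j / real K"] by (simp add: bin_def divide_right_mono)
  have "theta (step_fun K a) = (LINT x|lborel. (\<Sum>j=1..K. a j * indicator (bin K j) x))"
    unfolding theta_def set_lebesgue_integral_def step_fun_def
  proof (rule Bochner_Integration.integral_cong[OF refl])
    fix x :: real
    show "indicat_real {0..1} x *\<^sub>R (\<Sum>j = 1..K. a j * indicat_real (bin K j) x) =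
         (\<Sum>j = 1..K. a j * indicat_real (bin K j) x)"
    proof (cases "x \<in> {0..1}")
      case False
      hence "x \<notin> bin K j" if "j \<in> {1..K}" for j using sub[OF that] by blast
      hence "(\<Sum>j = 1..K. a j * indicat_real (bin K j) x) = 0" by (intro sum.neutral) auto
      thus ?thesis by simp
    qed simp
  qed
  also have "\<dots> = (\<Sum>j=1..K. a j * measure lborel (bin K j))"
    using fin by (subst Bochner_Integration.integral_sum) (auto intro!: integrable_mult_right integrable_real_indicator)
  also have "\<dots> = (\<Sum>j=1..K. a j) / real K"
    by (simp add: meas sum_divide_distrib)
  finally show ?thesis .
qed

text \<open>By Tonelli both measures agree on boxes, and for sigma-finite factors this determines
  the product measure.\<close>

lemma PiM_density:
  fixes f :: "'i \<Rightarrow> 'a \<Rightarrow> ennreal"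
  assumes I: "finite I" and M: "product_sigma_finite M"
    and f[measurable]: "\<And>i. i \<in> I \<Longrightarrow> f i \<in> borel_measurable (M i)"
    and D: "product_sigma_finite (\<lambda>i. density (M i) (f i))"
  shows "density (PiM I M) (\<lambda>x. \<Prod>i\<in>I. f i (x i)) = PiM I (\<lambda>i. density (M i) (f i))"
proof -
  interpret M: product_sigma_finite M by fact
  interpret D: product_sigma_finite "\<lambda>i. density (M i) (f i)" by fact
  have meas[measurable]: "(\<lambda>x. \<Prod>i\<in>I. f i (x i)) \<in> borel_measurable (PiM I M)"
    using I by (intro borel_measurable_prod_ennreal) auto
  show ?thesis
  proof (rule D.PiM_eqI[OF I])
    show "sets (density (Pi\<^sub>M I M) (\<lambda>x. \<Prod>i\<in>I. f i (x i))) = sets (Pi\<^sub>M I (\<lambda>i. density (M i) (f i)))"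
      by (simp cong: sets_PiM_cong)
  next
    fix A assume A: "\<And>i. i \<in> I \<Longrightarrow> A i \<in> sets (density (M i) (f i))"
    hence A'[measurable]: "\<And>i. i \<in> I \<Longrightarrow> A i \<in> sets (M i)" by simp
    have "emeasure (density (PiM I M) (\<lambda>x. \<Prod>i\<in>I. f i (x i))) (Pi\<^sub>E I A)
        = (\<integral>\<^sup>+x. (\<Prod>i\<in>I. f i (x i)) * indicator (Pi\<^sub>E I A) x \<partial>PiM I M)"
      using I by (subst emeasure_density) (auto intro!: sets_PiM_I_finite)
    also have "\<dots> = (\<integral>\<^sup>+x. (\<Prod>i\<in>I. f i (x i) * indicator (A i) (x i)) \<partial>PiM I M)"
    proof (rule nn_integral_cong)
      fix x assume x: "x \<in> space (PiM I M)"
      have "(\<Prod>i\<in>I. indicator (A i) (x i)) = (indicator (Pi\<^sub>E I A) x :: ennreal)"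
        using I x by (auto simp: indicator_def space_PiM PiE_iff prod_zero_iff)
      thus "(\<Prod>i\<in>I. f i (x i)) * indicator (Pi\<^sub>E I A) x = (\<Prod>i\<in>I. f i (x i) * indicator (A i) (x i))"
        by (simp add: prod.distrib)
    qed
    also have "\<dots> = (\<Prod>i\<in>I. \<integral>\<^sup>+x. f i x * indicator (A i) x \<partial>M i)"
      using I by (intro M.product_nn_integral_prod) auto
    also have "\<dots> = (\<Prod>i\<in>I. emeasure (density (M i) (f i)) (A i))"
      by (intro prod.cong refl) (simp add: emeasure_density)
    finally show "emeasure (density (PiM I M) (\<lambda>x. \<Prod>i\<in>I. f i (x i))) (Pi\<^sub>E I A)
      = (\<Prod>i\<in>I. emeasure (density (M i) (f i)) (A i))" .
  qed
qed

text \<open>The normalization of \<open>exp (l * x)\<close> on \<open>x \<le> h\<close>, which is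
  the factor that one bin contributes to the posterior: the law of \<open>h\<close> minus an
  exponential variable.\<close>

definition reflected_exponential :: "real \<Rightarrow> real \<Rightarrow> real measure" where
  "reflected_exponential l h = density lborel (\<lambda>x. ennreal (exponential_density l (h - x)))"

text \<open>The posterior is this law conditioned on \<open>\<forall>j. - R \<le> a j\<close>.\<close>

definition untruncated_posterior :: "nat \<Rightarrow> real \<Rightarrow> (nat \<Rightarrow> real) \<Rightarrow> (nat \<Rightarrow> real) measure" where
  "untruncated_posterior K l h = PiM {1..K} (\<lambda>j. reflected_exponential l (h j))"

lemma sets_reflected_exponential[simp, measurable_cong]: "sets (reflected_exponential l h) = sets borel"
  by (simp add: reflected_exponential_def)

lemma space_reflected_exponential[simp]: "space (reflected_exponential l h) = UNIV"
  by (simp add: reflected_exponential_def)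

lemma distr_reflected_exponential:
  "distr (reflected_exponential l h) lborel (\<lambda>x. h - x) = density lborel (exponential_density l)"
proof (rule measure_eqI)
  fix A assume "A \<in> sets (distr (reflected_exponential l h) lborel (\<lambda>x. h - x))"
  hence A[measurable]: "A \<in> sets borel" by simp
  have [measurable]: "(\<lambda>x. h - x) -` A \<in> sets borel"
    by (rule measurable_sets_borel[OF _ A]) simp
  have "emeasure (distr (reflected_exponential l h) lborel (\<lambda>x. h - x)) A
      = emeasure (reflected_exponential l h) ((\<lambda>x. h - x) -` A)"
    by (subst emeasure_distr) simp_all
  also have "\<dots> = (\<integral>\<^sup>+x. ennreal (exponential_density l (h - x)) * indicator A (h - x) \<partial>lborel)"
    unfolding reflected_exponential_def
    by (subst emeasure_density) (auto intro!: nn_integral_cong split: split_indicator)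
  also have "\<dots> = (\<integral>\<^sup>+x. ennreal (exponential_density l x) * indicator A x \<partial>lborel)"
    by (subst nn_integral_real_affine[where c="-1" and t=h]) auto
  finally show "emeasure (distr (reflected_exponential l h) lborel (\<lambda>x. h - x)) A
      = emeasure (density lborel (exponential_density l)) A"
    by (simp add: emeasure_density)
qed simp

lemma prob_space_reflected_exponential:
  assumes "l > 0" shows "prob_space (reflected_exponential l h)"
proof (rule prob_space_distrD)
  show "(\<lambda>x. h - x) \<in> reflected_exponential l h \<rightarrow>\<^sub>M lborel" by measurable
  show "prob_space (distr (reflected_exponential l h) lborel (\<lambda>x. h - x))"
    unfolding distr_reflected_exponential by (rule prob_space_exponential_density[OF assms])
qed

lemma prob_space_untruncated_posterior:
  assumes "l > 0" shows "prob_space (untruncated_posterior K l h)"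
  unfolding untruncated_posterior_def by (intro prob_space_PiM prob_space_reflected_exponential assms)

lemma sets_untruncated_posterior[measurable_cong]:
  "sets (untruncated_posterior K l h) = sets (PiM {1..K} (\<lambda>_. borel))"
  unfolding untruncated_posterior_def by (intro sets_PiM_cong) auto

lemma sets_param_space[measurable_cong]:
  "sets (param_space K) = sets (PiM {1..K} (\<lambda>_. borel))"
  unfolding param_space_def by (intro sets_PiM_cong) auto

lemma distributed_untruncated_posterior:
  assumes "l > 0" "j \<in> {1..K}"
  shows "distributed (untruncated_posterior K l h) lborel (\<lambda>a. h j - a j) (exponential_density l)"
  unfolding distributed_def
proof safe
  show m[measurable]: "(\<lambda>a. h j - a j) \<in> untruncated_posterior K l h \<rightarrow>\<^sub>M lborel"
    using assms by measurable
  have "distr (untruncated_posterior K l h) lborel (\<lambda>a. h j - a j) =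
    distr (distr (untruncated_posterior K l h) (reflected_exponential l (h j)) (\<lambda>a. a j)) lborel (\<lambda>x. h j - x)"
    using assms by (subst distr_distr) (auto simp: comp_def)
  also have "distr (untruncated_posterior K l h) (reflected_exponential l (h j)) (\<lambda>a. a j) = reflected_exponential l (h j)"
    unfolding untruncated_posterior_def
    using assms by (intro distr_PiM_component[where M="\<lambda>j. reflected_exponential l (h j)"] prob_space_reflected_exponential)
  finally show "distr (untruncated_posterior K l h) lborel (\<lambda>a. h j - a j) = density lborel (exponential_density l)"
    by (simp add: distr_reflected_exponential)
qed simp

lemma indep_untruncated_posterior:
  assumes "l > 0" "K > 0"
  shows "prob_space.indep_vars (untruncated_posterior K l h) (\<lambda>_. borel) (\<lambda>j a. h j - a j) {1..K}"
proof -
  interpret prob_space "untruncated_posterior K l h" by (rule prob_space_untruncated_posterior[OF assms(1)])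
  let ?M = "\<lambda>j. reflected_exponential l (h j)"
  have "indep_vars ?M (\<lambda>j a. a j) {1..K}"
  proof (subst indep_vars_iff_distr_eq_PiM')
    show "{1..K} \<noteq> {}" using assms by auto
    show "(\<lambda>a. a j) \<in> untruncated_posterior K l h \<rightarrow>\<^sub>M ?M j" if "j \<in> {1..K}" for j
      using that by measurable
    have "distr (untruncated_posterior K l h) (PiM {1..K} ?M) (\<lambda>x. \<lambda>i\<in>{1..K}. x i)
      = distr (untruncated_posterior K l h) (PiM {1..K} ?M) (\<lambda>x. x)"
      by (intro distr_cong refl) (auto simp: untruncated_posterior_def space_PiM PiE_iff restrict_def fun_eq_iff extensional_def)
    also have "\<dots> = PiM {1..K} ?M" unfolding untruncated_posterior_def by (rule distr_id)
    also have "\<dots> = PiM {1..K} (\<lambda>j. distr (untruncated_posterior K l h) (?M j) (\<lambda>a. a j))"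
      unfolding untruncated_posterior_def
      by (intro PiM_cong refl, subst distr_PiM_component) (auto intro: prob_space_reflected_exponential assms)
    finally show "distr (untruncated_posterior K l h) (PiM {1..K} ?M) (\<lambda>x. \<lambda>i\<in>{1..K}. x i)
      = PiM {1..K} (\<lambda>j. distr (untruncated_posterior K l h) (?M j) (\<lambda>a. a j))" .
  qed
  thus ?thesis
    by (rule indep_vars_compose2[where Y="\<lambda>j x. h j - x"]) measurable
qed

text \<open>Multiplying by the rate \<open>l\<close> standardizes the scale. The index is
  \<open>K - 1\<close> because \<open>erlang_density k\<close> is the Gamma density of shape
  \<open>k + 1\<close>.\<close>

lemma distributed_sum_untruncated_posterior:
  assumes "l > 0" "K > 0"
  shows "distributed (untruncated_posterior K l h) lborel (\<lambda>a. l * (\<Sum>j=1..K. h j - a j)) (erlang_density (K - 1) 1)"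
proof -
  interpret prob_space "untruncated_posterior K l h" by (rule prob_space_untruncated_posterior[OF assms(1)])
  have "distributed (untruncated_posterior K l h) lborel (\<lambda>a. \<Sum>j\<in>{1..K}. h j - a j) (erlang_density (card {1..K} - 1) l)"
    using assms by (intro exponential_distributed_sum distributed_untruncated_posterior indep_untruncated_posterior) auto
  from erlang_distributed_mult_const[OF this assms(1) assms(1)] show ?thesis
    using assms by simp
qed

section \<open>Normal approximation of the untruncated posterior\<close>

lemma measure_density_diff_le:
  fixes f g :: "real \<Rightarrow> real"
  assumes f: "integrable lborel f" "\<And>x. f x \<ge> 0" and g: "integrable lborel g" "\<And>x. g x \<ge> 0"
    and A[measurable]: "A \<in> sets borel"
  shows "\<bar>measure (density lborel (\<lambda>x. ennreal (f x))) A - measure (density lborel (\<lambda>x. ennreal (g x))) A\<bar>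
    \<le> (LINT x|lborel. \<bar>f x - g x\<bar>)"
proof -
  have *: "measure (density lborel (\<lambda>x. ennreal (f x))) A = (LINT x|lborel. f x * indicator A x)"
    if f: "integrable lborel f" "\<And>x. f x \<ge> 0" for f :: "real \<Rightarrow> real"
  proof -
    have [measurable]: "f \<in> borel_measurable borel" using f by auto
    have "emeasure (density lborel (\<lambda>x. ennreal (f x))) A = (\<integral>\<^sup>+x. ennreal (f x * indicator A x) \<partial>lborel)"
      by (subst emeasure_density) (auto intro!: nn_integral_cong split: split_indicator)
    also have "\<dots> = ennreal (LINT x|lborel. f x * indicator A x)"
      using f by (intro nn_integral_eq_integral integrable_real_mult_indicator) auto
    finally show ?thesis
      using f by (simp add: measure_def integral_nonneg_AE)
  qed
  have i: "integrable lborel (\<lambda>x. f x * indicator A x)" "integrable lborel (\<lambda>x. g x * indicator A x)"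
    using f g by (auto intro: integrable_real_mult_indicator)
  have "\<bar>(LINT x|lborel. f x * indicator A x) - (LINT x|lborel. g x * indicator A x)\<bar>
      = \<bar>LINT x|lborel. f x * indicator A x - g x * indicator A x\<bar>"
    using i by simp
  also have "\<dots> \<le> (LINT x|lborel. \<bar>f x * indicator A x - g x * indicator A x\<bar>)"
    by (rule integral_abs_bound)
  also have "\<dots> \<le> (LINT x|lborel. \<bar>f x - g x\<bar>)"
    using i f g by (intro integral_mono integrable_abs Bochner_Integration.integrable_diff)
       (auto split: split_indicator)
  finally show ?thesis using *[OF f] *[OF g] by simp
qed

text \<open>Writes the limit law as that of \<open>m - Z / n\<close> with \<open>Z\<close> normal of
  mean and variance \<open>K\<close>. The posterior functional is \<open>m - S / n\<close> with
  \<open>S\<close> Gamma distributed, so only the densities of \<open>S\<close> and \<open>Z\<close>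
  remain to be compared, on one common set.\<close>

lemma normal_law_reflect:
  assumes n: "n > 0" and K: "K > 0" and B[measurable]: "B \<in> sets borel"
  shows "measure (normal_law (m - real K / real n) (real K / real n ^ 2)) B
    = measure (density lborel (\<lambda>x. ennreal (normal_density (real K) (sqrt K) x))) {x. m - x / real n \<in> B}"
proof -
  let ?D = "density lborel (\<lambda>x. ennreal (normal_density (real K) (sqrt K) x))"
  interpret prob_space ?D using K by (intro prob_space_normal_density) auto
  have "distributed ?D lborel (\<lambda>x. x) (normal_density (real K) (sqrt K))"
    unfolding distributed_def by (auto simp: distr_id2)
  hence "distributed ?D lborel (\<lambda>x. m + (- (1 / real n)) * x)
      (normal_density (m + (- (1 / real n)) * real K) (\<bar>- (1 / real n)\<bar> * sqrt K))"
    using n K by (intro normal_density_affine) auto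
  also have "\<bar>- (1 / real n)\<bar> * sqrt K = sqrt (real K / real n ^ 2)"
    using n by (simp add: real_sqrt_divide)
  finally have "distr ?D lborel (\<lambda>x. m + (- (1 / real n)) * x) = normal_law (m - real K / real n) (real K / real n ^ 2)"
    unfolding normal_law_def by (simp add: distributed_distr_eq_density)
  hence "measure (normal_law (m - real K / real n) (real K / real n ^ 2)) B
    = measure (distr ?D lborel (\<lambda>x. m + (- (1 / real n)) * x)) B" by simp
  also have "\<dots> = measure ?D {x. m - x / real n \<in> B}"
    by (subst measure_distr) (auto intro!: arg_cong[where f="measure ?D"])
  finally show ?thesis .
qed

lemma normal_approx_error_eq:
  assumes "K > 0"
  shows "(LINT x|lborel. \<bar>erlang_density (K - 1) 1 x - normal_density (real K) (sqrt K) x\<bar>) = normal_approx_error K"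
proof -
  have *: "sqrt K * normal_density (real K) (sqrt K) (real K + sqrt K * z) = std_normal_density z" for z
    using assms by (simp add: normal_density_def real_sqrt_mult power_mult_distrib)
  have "(LINT x|lborel. \<bar>erlang_density (K - 1) 1 x - normal_density (real K) (sqrt K) x\<bar>)
    = sqrt K * (LINT z|lborel. \<bar>erlang_density (K - 1) 1 (real K + sqrt K * z) - normal_density (real K) (sqrt K) (real K + sqrt K * z)\<bar>)"
    using assms by (subst lborel_integral_real_affine[where c="sqrt K" and t="real K"]) auto
  also have "\<dots> = (LINT z|lborel. \<bar>sqrt K * erlang_density (K - 1) 1 (real K + sqrt K * z) - sqrt K * normal_density (real K) (sqrt K) (real K + sqrt K * z)\<bar>)"
    by (simp flip: right_diff_distrib add: abs_mult)
  finally show ?thesis by (simp add: * normal_approx_error_def)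
qed

lemma untruncated_posterior_normal_approx:
  fixes h :: "nat \<Rightarrow> real"
  assumes n: "n > 0" and K: "K > 0" and B[measurable]: "B \<in> sets borel"
  defines "P \<equiv> untruncated_posterior K (real n / real K) h"
  shows "\<bar>measure P {a \<in> space P. (\<Sum>j=1..K. a j) / real K \<in> B} -
      measure (normal_law ((\<Sum>j=1..K. h j) / real K - real K / real n) (real K / real n ^ 2)) B\<bar>
    \<le> normal_approx_error K"
proof -
  define l where "l = real n / real K"
  have l: "l > 0" using n K by (simp add: l_def)
  define m where "m = (\<Sum>j=1..K. h j) / real K"
  define S where "S = (\<lambda>a. l * (\<Sum>j=1..K. h j - a j))"
  have S: "distributed P lborel S (erlang_density (K - 1) 1)"
    unfolding P_def S_def l_def[symmetric] by (rule distributed_sum_untruncated_posterior[OF l K])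
  have [measurable]: "S \<in> borel_measurable P"
    using distributed_measurable[OF S] by simp
  \<comment> \<open>The denominators combine because \<open>l * K = n\<close>.\<close>
  have eq: "(\<Sum>j=1..K. a j) / real K = m - S a / real n" for a
    using n K by (simp add: m_def S_def l_def sum_subtractf field_simps)
  have "measure P {a \<in> space P. (\<Sum>j=1..K. a j) / real K \<in> B} = measure (distr P lborel S) {x. m - x / real n \<in> B}"
    unfolding eq by (subst measure_distr) (auto intro!: arg_cong[where f="measure P"])
  also have "\<dots> = measure (density lborel (erlang_density (K - 1) 1)) {x. m - x / real n \<in> B}"
    by (simp add: distributed_distr_eq_density[OF S])
  finally have 1: "measure P {a \<in> space P. (\<Sum>j=1..K. a j) / real K \<in> B} = \<dots>" .
  interpret E: prob_space "density lborel (erlang_density (K - 1) 1)"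
    by (rule prob_space_erlang_density) simp
  have i: "integrable lborel (erlang_density (K - 1) 1)"
    using E.emeasure_space_1 by (intro integrableI_nonneg) (auto simp: emeasure_density)
  show ?thesis
    unfolding 1 m_def[symmetric] normal_law_reflect[OF n K B] normal_approx_error_eq[OF K, symmetric]
    using i K by (intro measure_density_diff_le) (auto simp: integrable_normal_density)
qed

text \<open>To pass below \<open>- R\<close>, the exponential variable \<open>h j - a j\<close> has
  to exceed \<open>h j + R\<close>, which is at least \<open>R\<close>; a union bound does the
  rest.\<close>

lemma untruncated_posterior_tail:
  assumes l: "l > 0" and K: "K > 0" and R: "R \<ge> 0" and h: "\<And>j. j \<in> {1..K} \<Longrightarrow> h j \<ge> 0"
  defines "P \<equiv> untruncated_posterior K l h"
  shows "measure P {a \<in> space P. \<not> (\<forall>j\<in>{1..K}. - R \<le> a j)} \<le> real K * exp (- (l * R))"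
proof -
  interpret prob_space P unfolding P_def by (rule prob_space_untruncated_posterior[OF l])
  have [measurable_cong]: "sets P = sets (PiM {1..K} (\<lambda>_. borel))"
    unfolding P_def by (rule sets_untruncated_posterior)
  have "prob {a \<in> space P. \<not> (\<forall>j\<in>{1..K}. - R \<le> a j)} = prob (\<Union>j\<in>{1..K}. {a \<in> space P. a j < - R})"
    by (intro arg_cong[where f=prob]) (auto simp: not_le)
  also have "\<dots> \<le> (\<Sum>j\<in>{1..K}. prob {a \<in> space P. a j < - R})"
    by (intro finite_measure_subadditive_finite) (auto, measurable)
  also have "\<dots> \<le> (\<Sum>j\<in>{1..K}. exp (- (l * R)))"
  proof (rule sum_mono)
    fix j assume j: "j \<in> {1..K}"
    have "prob {a \<in> space P. a j < - R} = prob {a \<in> space P. h j + R < h j - a j}"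
      by (intro arg_cong[where f=prob]) auto
    also have "\<dots> = exp (- (h j + R) * l)"
      using h[OF j] R l unfolding P_def
      by (intro prob_space.exponential_distributedD_gt prob_space_untruncated_posterior distributed_untruncated_posterior j) auto
    also have "\<dots> \<le> exp (- (l * R))"
      using h[OF j] l by (simp add: algebra_simps)
    finally show "prob {a \<in> space P. a j < - R} \<le> exp (- (l * R))" .
  qed
  finally show ?thesis by simp
qed

section \<open>Measurability and total mass of the posterior\<close>

lemma measurable_step_fun[measurable]:
  assumes [measurable]: "f \<in> M \<rightarrow>\<^sub>M PiM {1..K} (\<lambda>_. borel)" "g \<in> borel_measurable M"
  shows "(\<lambda>x. step_fun K (f x) (g x)) \<in> borel_measurable M"
  unfolding step_fun_def by measurable

lemma measurable_theta_step_fun[measurable]: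
  assumes "K > 0" and [measurable]: "f \<in> M \<rightarrow>\<^sub>M PiM {1..K} (\<lambda>_. borel)"
  shows "(\<lambda>x. theta (step_fun K (f x))) \<in> borel_measurable M"
  unfolding theta_step_fun[OF assms(1)] by measurable

lemma measurable_prior_g[measurable]: "prior_g R \<in> borel_measurable borel"
  unfolding prior_g_def[abs_def] by measurable

text \<open>The data may vary together with the parameter: joint measurability is what
  \<open>measurable_post_CI\<close> integrates over. Constant data give the version below.\<close>

lemma measurable_posterior_weight:
  assumes "K > 0" and [measurable]: "f \<in> M \<rightarrow>\<^sub>M PiM {1..K} (\<lambda>_. borel)"
    "\<And>i. xs i \<in> borel_measurable M" "\<And>i. ys i \<in> borel_measurable M"
  shows "(\<lambda>x. posterior_weight n K R (\<lambda>i. xs i x) (\<lambda>i. ys i x) (f x)) \<in> borel_measurable M"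
proof -
  have [measurable]: "(\<lambda>x. theta (step_fun K (f x))) \<in> borel_measurable M"
    using assms(1) by measurable
  show ?thesis unfolding posterior_weight_def by measurable
qed

lemma measurable_posterior_weight_param[measurable]:
  assumes "K > 0"
  shows "posterior_weight n K R xs ys \<in> borel_measurable (param_space K)"
  using measurable_posterior_weight[OF assms, of "\<lambda>a. a" "param_space K" "\<lambda>i a. xs i" "\<lambda>i a. ys i" n R]
  by (simp add: measurable_ident_sets sets_param_space)

lemma emeasure_posterior:
  assumes "K > 0" and "E \<in> sets (param_space K)"
  shows "emeasure (posterior n K R xs ys) E =
    (\<integral>\<^sup>+a. ennreal (posterior_weight n K R xs ys a) * indicator E a \<partial>param_space K) /
    (\<integral>\<^sup>+a. ennreal (posterior_weight n K R xs ys a) \<partial>param_space K)"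
proof -
  note [measurable] = assms(2) measurable_posterior_weight_param[OF assms(1)]
  have "emeasure (posterior n K R xs ys) E =
    (\<integral>\<^sup>+a. (ennreal (posterior_weight n K R xs ys a) * indicator E a) /
       (\<integral>\<^sup>+a. ennreal (posterior_weight n K R xs ys a) \<partial>param_space K) \<partial>param_space K)"
    unfolding posterior_def
    by (subst emeasure_density) (auto intro!: nn_integral_cong split: split_indicator)
  thus ?thesis by (simp add: nn_integral_divide)
qed

lemma emeasure_posterior_theta:
  assumes "K > 0" and [measurable]: "B \<in> sets borel"
  shows "emeasure (posterior_theta n K R xs ys) B =
    (\<integral>\<^sup>+a. ennreal (posterior_weight n K R xs ys a) * indicator B ((\<Sum>j=1..K. a j) / real K) \<partial>param_space K) /
    (\<integral>\<^sup>+a. ennreal (posterior_weight n K R xs ys a) \<partial>param_space K)"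
proof -
  let ?E = "{a \<in> space (param_space K). (\<Sum>j=1..K. a j) / real K \<in> B}"
  have E: "?E \<in> sets (param_space K)" by measurable
  have "emeasure (posterior_theta n K R xs ys) B = emeasure (posterior n K R xs ys) ?E"
    unfolding posterior_theta_def theta_step_fun[OF assms(1)]
    by (subst emeasure_distr) (auto simp: posterior_def intro!: arg_cong[where f="emeasure _"])
  also have "\<dots> = (\<integral>\<^sup>+a. ennreal (posterior_weight n K R xs ys a) * indicator ?E a \<partial>param_space K) /
    (\<integral>\<^sup>+a. ennreal (posterior_weight n K R xs ys a) \<partial>param_space K)"
    by (rule emeasure_posterior[OF assms(1) E])
  also have "(\<integral>\<^sup>+a. ennreal (posterior_weight n K R xs ys a) * indicator ?E a \<partial>param_space K) =
    (\<integral>\<^sup>+a. ennreal (posterior_weight n K R xs ys a) * indicator B ((\<Sum>j=1..K. a j) / real K) \<partial>param_space K)"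
    by (intro nn_integral_cong) (auto split: split_indicator)
  finally show ?thesis .
qed

text \<open>This covers all data, also those whose normalizing constant is 0 or infinite, since
  \<open>0 / 0\<close> and \<open>top / top\<close> are 0 in \<open>ennreal\<close>. It supplies the
  trivial bound on the bad event.\<close>

lemma emeasure_posterior_theta_le_1:
  assumes "K > 0"
  shows "emeasure (posterior_theta n K R xs ys) B \<le> 1"
proof (cases "B \<in> sets borel")
  case True
  let ?c = "\<integral>\<^sup>+a. ennreal (posterior_weight n K R xs ys a) \<partial>param_space K"
  have "emeasure (posterior_theta n K R xs ys) B \<le> ?c / ?c"
    unfolding emeasure_posterior_theta[OF assms True]
    by (intro divide_right_mono_ennreal nn_integral_mono) (auto split: split_indicator)
  also have "?c / ?c \<le> 1"
    by (cases "?c = 0 \<or> ?c = top") (auto simp: ennreal_divide_self top.not_eq_extremum)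
  finally show ?thesis .
qed (simp add: emeasure_notin_sets posterior_theta_def)

lemma measure_posterior_theta_le_1: "K > 0 \<Longrightarrow> measure (posterior_theta n K R xs ys) B \<le> 1"
  using emeasure_posterior_theta_le_1[of K n R xs ys B]
  by (simp add: measure_def enn2real_leI)

lemma prob_space_normal_law: "v > 0 \<Longrightarrow> prob_space (normal_law m v)"
  unfolding normal_law_def by (intro prob_space_normal_density) auto

text \<open>The exponent is \<open>l\<close> times the sum of the coefficients, so the weight
  factors over the bins, and \<open>exp (l * a) = exp (l * h) * exp (- l * (h - a))\<close> exposes
  the exponential density. Because \<open>h j \<le> R\<close>, the constraint
  \<open>a j \<le> h j\<close> already implies the upper end of the prior support; only the lower
  end survives, as an indicator.\<close>

lemma posterior_weight_eq:
  assumes n: "n > 0" and K: "K > 0" and R: "R > 0"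
    and h: "\<And>j. j \<in> {1..K} \<Longrightarrow> 0 \<le> h j \<and> h j \<le> R"
    and feas: "\<And>a. (\<forall>i. step_fun K a (xs i) \<le> ys i) \<longleftrightarrow> (\<forall>j\<in>{1..K}. a j \<le> h j)"
  defines "l \<equiv> real n / real K"
  shows "posterior_weight n K R xs ys a =
    (\<Prod>j=1..K. exp (l * h j) / (2 * R * l)) * (\<Prod>j=1..K. exponential_density l (h j - a j)) *
    indicator {a. \<forall>j\<in>{1..K}. - R \<le> a j} a"
proof -
  have l: "l > 0" using n K by (simp add: l_def)
  have 1: "exp (real n * theta (step_fun K a)) = (\<Prod>j=1..K. exp (l * a j))"
    by (simp add: theta_step_fun[OF K] l_def exp_sum[symmetric] sum_distrib_left[symmetric] sum_divide_distrib[symmetric])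
  have 2: "(if \<forall>i. step_fun K a (xs i) \<le> ys i then 1 else 0 :: real) = (\<Prod>j=1..K. if a j \<le> h j then 1 else 0)"
    unfolding feas by (auto simp: prod_zero_iff)
  have 3: "indicator {a. \<forall>j\<in>{1..K}. - R \<le> a j} a = (\<Prod>j=1..K. indicator {-R..} (a j) :: real)"
    by (auto simp: indicator_def prod_zero_iff)
  have "posterior_weight n K R xs ys a = (\<Prod>j=1..K. exp (l * a j) * (if a j \<le> h j then 1 else 0) * prior_g R (a j))"
    unfolding posterior_weight_def 1 2 by (simp add: prod.distrib)
  also have "\<dots> = (\<Prod>j=1..K. exp (l * h j) / (2 * R * l) * exponential_density l (h j - a j) * indicator {-R..} (a j))"
  proof (rule prod.cong[OF refl])
    fix j assume j: "j \<in> {1..K}"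
    show "exp (l * a j) * (if a j \<le> h j then 1 else 0) * prior_g R (a j) =
      exp (l * h j) / (2 * R * l) * exponential_density l (h j - a j) * indicator {-R..} (a j)"
    proof (cases "a j \<le> h j \<and> - R \<le> a j")
      case True
      have "exp (l * h j) * exp (- (h j - a j) * l) = exp (l * a j)"
        unfolding exp_add[symmetric] by (simp add: algebra_simps)
      thus ?thesis using True h[OF j] l R
        by (auto simp: prior_g_def exponential_density_def field_simps)
    next
      case False
      thus ?thesis using h[OF j] by (auto simp: prior_g_def exponential_density_def indicator_def)
    qed
  qed
  also have "\<dots> = (\<Prod>j=1..K. exp (l * h j) / (2 * R * l)) * (\<Prod>j=1..K. exponential_density l (h j - a j)) *
    (\<Prod>j=1..K. indicator {-R..} (a j))"
    by (simp only: prod.distrib)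
  finally show ?thesis by (simp only: 3)
qed

lemma untruncated_posterior_eq_density:
  assumes "l > 0"
  shows "untruncated_posterior K l h =
    density (param_space K) (\<lambda>a. ennreal (\<Prod>j=1..K. exponential_density l (h j - a j)))"
proof -
  have psf: "product_sigma_finite (\<lambda>j. density lborel (\<lambda>x. ennreal (exponential_density l (h j - x))))"
    using prob_space_reflected_exponential[OF assms] unfolding reflected_exponential_def
    by (intro product_sigma_finite.intro prob_space_imp_sigma_finite)
  have psl: "product_sigma_finite (\<lambda>_::nat. lborel :: real measure)"
    by (intro product_sigma_finite.intro sigma_finite_lborel)
  have "untruncated_posterior K l h = density (param_space K) (\<lambda>a. \<Prod>j=1..K. ennreal (exponential_density l (h j - a j)))"
    unfolding untruncated_posterior_def reflected_exponential_def param_space_def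
    by (rule PiM_density[symmetric, OF _ psl _ psf]) simp_all
  thus ?thesis using assms by (simp add: prod_ennreal)
qed

lemma posterior_theta_eq_conditional:
  assumes n: "n > 0" and K: "K > 0" and R: "R > 0"
    and h: "\<And>j. j \<in> {1..K} \<Longrightarrow> 0 \<le> h j \<and> h j \<le> R"
    and feas: "\<And>a. (\<forall>i. step_fun K a (xs i) \<le> ys i) \<longleftrightarrow> (\<forall>j\<in>{1..K}. a j \<le> h j)"
    and B[measurable]: "B \<in> sets borel"
  defines "P \<equiv> untruncated_posterior K (real n / real K) h"
  shows "measure (posterior_theta n K R xs ys) B =
    measure P {a \<in> space P. (\<forall>j\<in>{1..K}. - R \<le> a j) \<and> (\<Sum>j=1..K. a j) / real K \<in> B} /
    measure P {a \<in> space P. \<forall>j\<in>{1..K}. - R \<le> a j}"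
proof -
  define l where "l = real n / real K"
  have l: "l > 0" using n K by (simp add: l_def)
  interpret prob_space P unfolding P_def by (intro prob_space_untruncated_posterior) (use l l_def in auto)
  define C where "C = (\<Prod>j=1..K. exp (l * h j) / (2 * R * l))"
  have C: "C > 0" unfolding C_def using l R by (intro prod_pos) auto
  have [measurable_cong]: "sets P = sets (PiM {1..K} (\<lambda>_. borel))"
    unfolding P_def by (rule sets_untruncated_posterior)
  have sp: "space P = space (param_space K)"
    by (rule sets_eq_imp_space_eq) (simp add: sets_param_space P_def sets_untruncated_posterior)
  define q where "q = (\<lambda>a. \<Prod>j=1..K. exponential_density l (h j - a j))"
  have [measurable]: "q \<in> borel_measurable (param_space K)" unfolding q_def by measurable
  have P: "P = density (param_space K) (\<lambda>a. ennreal (q a))"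
    unfolding P_def q_def l_def[symmetric] by (rule untruncated_posterior_eq_density[OF l])
  have q0: "q a \<ge> 0" for a unfolding q_def using l by (intro prod_nonneg) auto
  have w: "posterior_weight n K R xs ys a = C * q a * indicator {a. \<forall>j\<in>{1..K}. - R \<le> a j} a" for a
    unfolding C_def q_def l_def by (rule posterior_weight_eq[OF n K R h feas])
  \<comment> \<open>Used twice: \<open>D = B\<close> gives the numerator and \<open>D = UNIV\<close>
    the normalizing constant, so that \<open>C\<close> cancels.\<close>
  have *: "(\<integral>\<^sup>+a. ennreal (posterior_weight n K R xs ys a) * indicator D ((\<Sum>j=1..K. a j) / real K) \<partial>param_space K)
      = ennreal (C * prob {a \<in> space P. (\<forall>j\<in>{1..K}. - R \<le> a j) \<and> (\<Sum>j=1..K. a j) / real K \<in> D})"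
    if D[measurable]: "D \<in> sets borel" for D
  proof -
    let ?E = "{a \<in> space P. (\<forall>j\<in>{1..K}. - R \<le> a j) \<and> (\<Sum>j=1..K. a j) / real K \<in> D}"
    have E: "?E \<in> sets (param_space K)" unfolding sp by measurable
    have "(\<integral>\<^sup>+a. ennreal (posterior_weight n K R xs ys a) * indicator D ((\<Sum>j=1..K. a j) / real K) \<partial>param_space K)
      = (\<integral>\<^sup>+a. ennreal C * (ennreal (q a) * indicator ?E a) \<partial>param_space K)"
    proof (rule nn_integral_cong)
      fix a assume "a \<in> space (param_space K)"
      thus "ennreal (posterior_weight n K R xs ys a) * indicator D ((\<Sum>j=1..K. a j) / real K) =
        ennreal C * (ennreal (q a) * indicator ?E a)"
        using C q0[of a] unfolding w by (auto simp: ennreal_mult sp split: split_indicator)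
    qed
    also have "\<dots> = ennreal C * emeasure P ?E"
      using E by (simp add: nn_integral_cmult P emeasure_density)
    also have "\<dots> = ennreal (C * prob ?E)"
      using C by (simp add: emeasure_eq_measure ennreal_mult)
    finally show ?thesis .
  qed
  have den: "(\<integral>\<^sup>+a. ennreal (posterior_weight n K R xs ys a) \<partial>param_space K)
      = ennreal (C * prob {a \<in> space P. \<forall>j\<in>{1..K}. - R \<le> a j})"
    using *[of UNIV] by simp
  have A: "{a \<in> space P. \<forall>j\<in>{1..K}. - R \<le> a j} \<in> events" by measurable
  show ?thesis
  proof (cases "prob {a \<in> space P. \<forall>j\<in>{1..K}. - R \<le> a j} = 0")
    \<comment> \<open>Both sides are 0 by convention: a quotient \<open>0 / 0\<close> in
      \<open>ennreal\<close> on the left and in the reals on the right.\<close>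
    case True
    have "prob {a \<in> space P. (\<forall>j\<in>{1..K}. - R \<le> a j) \<and> (\<Sum>j=1..K. a j) / real K \<in> B}
        \<le> prob {a \<in> space P. \<forall>j\<in>{1..K}. - R \<le> a j}"
      by (rule finite_measure_mono[OF _ A]) blast
    hence "prob {a \<in> space P. (\<forall>j\<in>{1..K}. - R \<le> a j) \<and> (\<Sum>j=1..K. a j) / real K \<in> B} = 0"
      unfolding True by (rule antisym[OF _ measure_nonneg])
    thus ?thesis
      unfolding measure_def[of "posterior_theta n K R xs ys"] emeasure_posterior_theta[OF K B] *[OF B] den
      using True by simp
  next
    case False
    hence "prob {a \<in> space P. \<forall>j\<in>{1..K}. - R \<le> a j} > 0"
      using measure_nonneg[of P] by (simp add: less_le)
    thus ?thesis
      unfolding measure_def[of "posterior_theta n K R xs ys"] emeasure_posterior_theta[OF K B] *[OF B] den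
      using C by (simp add: divide_ennreal)
  qed
qed

text \<open>Conditioning on an event changes no probability by more than the probability of the
  complement, and here the complement is the lower tail.\<close>

lemma posterior_theta_normal_approx:
  assumes n: "n > 0" and K: "K > 0" and R: "R > 0"
    and h: "\<And>j. j \<in> {1..K} \<Longrightarrow> 0 \<le> h j \<and> h j \<le> R"
    and feas: "\<And>a. (\<forall>i. step_fun K a (xs i) \<le> ys i) \<longleftrightarrow> (\<forall>j\<in>{1..K}. a j \<le> h j)"
    and B[measurable]: "B \<in> sets borel"
  shows "\<bar>measure (posterior_theta n K R xs ys) B -
      measure (normal_law ((\<Sum>j=1..K. h j) / real K - real K / real n) (real K / real n ^ 2)) B\<bar>
    \<le> normal_approx_error K + real K * exp (- (real n / real K * R))"
proof -
  define l where "l = real n / real K"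
  have l: "l > 0" using n K by (simp add: l_def)
  define P where "P = untruncated_posterior K l h"
  interpret prob_space P unfolding P_def by (rule prob_space_untruncated_posterior[OF l])
  have [measurable_cong]: "sets P = sets (PiM {1..K} (\<lambda>_. borel))"
    unfolding P_def by (rule sets_untruncated_posterior)
  let ?A = "{a \<in> space P. \<forall>j\<in>{1..K}. - R \<le> a j}"
  let ?E = "{a \<in> space P. (\<Sum>j=1..K. a j) / real K \<in> B}"
  let ?AE = "{a \<in> space P. (\<forall>j\<in>{1..K}. - R \<le> a j) \<and> (\<Sum>j=1..K. a j) / real K \<in> B}"
  let ?C = "{a \<in> space P. \<not> (\<forall>j\<in>{1..K}. - R \<le> a j)}"
  have sets: "?A \<in> events" "?E \<in> events" "?AE \<in> events" "?C \<in> events" by measurable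
  have tail: "prob ?C \<le> real K * exp (- (l * R))"
    unfolding P_def using h R by (intro untruncated_posterior_tail[OF l K]) auto
  have A: "prob ?A = 1 - prob ?C"
    using sets by (subst prob_compl[symmetric]) (auto intro!: arg_cong[where f=prob])
  have "prob ?E \<le> prob (?AE \<union> ?C)" using sets by (intro finite_measure_mono) auto
  also have "\<dots> \<le> prob ?AE + prob ?C" using sets by (intro measure_Un_le)
  finally have u: "prob ?E \<le> prob ?AE + prob ?C" .
  have v: "prob ?AE \<le> prob ?E" "prob ?AE \<le> prob ?A" using sets by (auto intro!: finite_measure_mono)
  define r where "r = prob ?AE / prob ?A"
  have "\<bar>r - prob ?E\<bar> \<le> prob ?C"
  proof (cases "prob ?A = 0")
    case True
    hence "prob ?C = 1" "r = 0" using A by (auto simp: r_def)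
    thus ?thesis by simp
  next
    case False
    hence pA: "prob ?A > 0" "prob ?A \<le> 1" using measure_nonneg[of P ?A] by (auto simp: less_le)
    have "r * prob ?A = prob ?AE" using pA by (simp add: r_def)
    moreover have r: "0 \<le> r" "r \<le> 1" using pA v by (auto simp: r_def)
    \<comment> \<open>The conditional probability \<open>r\<close> exceeds \<open>prob ?AE\<close>
      by at most \<open>prob ?C\<close>, and so does \<open>prob ?E\<close>; hence they differ by at
      most \<open>prob ?C\<close>.\<close>
    ultimately have "r - prob ?AE = r * prob ?C" unfolding A by (simp add: algebra_simps)
    moreover have "r * prob ?C \<le> 1 * prob ?C" "0 \<le> r * prob ?C"
      using r by (intro mult_right_mono mult_nonneg_nonneg measure_nonneg; simp)+
    ultimately show ?thesis using u v by linarith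
  qed
  moreover have "measure (posterior_theta n K R xs ys) B = r"
    unfolding r_def P_def l_def by (rule posterior_theta_eq_conditional[OF n K R h feas B])
  moreover have "\<bar>prob ?E - measure (normal_law ((\<Sum>j=1..K. h j) / real K - real K / real n) (real K / real n ^ 2)) B\<bar>
    \<le> normal_approx_error K"
    unfolding P_def l_def by (rule untruncated_posterior_normal_approx[OF n K B])
  ultimately show ?thesis using tail unfolding l_def by linarith
qed

section \<open>Bin minima of the Poisson process\<close>

text \<open>One fixed sample size: all bounds inside are nonasymptotic.\<close>

locale boundary_sample =
  fixes M :: "'w measure" and n K :: nat and f :: "real \<Rightarrow> real" and X Y :: "nat \<Rightarrow> 'w \<Rightarrow> real"
  assumes model: "boundary_model M n f X Y"
    and f: "\<forall>x\<in>{0..1}. f x = x"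
    and n: "n > 0" and K: "K > 0"
begin

abbreviation "\<mu> \<equiv> intensity n f"

lemma ppp: "poisson_point_process M \<mu> (\<lambda>\<omega>. point_measure_of (\<lambda>i. X i \<omega>) (\<lambda>i. Y i \<omega>))"
  using model by (simp add: boundary_model_def)

sublocale prob_space M
  using ppp by (simp add: poisson_point_process_def)

lemma measurable_X[measurable]: "X i \<in> borel_measurable M"
  and measurable_Y[measurable]: "Y i \<in> borel_measurable M"
  using model by (auto simp: boundary_model_def)

lemma sets_intensity: "sets \<mu> = sets borel"
  by (simp add: intensity_def)

lemma emeasure_points_eq_0_iff:
  assumes "B \<in> sets borel"
  shows "emeasure (point_measure_of (\<lambda>i. X i \<omega>) (\<lambda>i. Y i \<omega>)) B = 0 \<longleftrightarrow> (\<forall>i. (X i \<omega>, Y i \<omega>) \<notin> B)"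
  using assms by (auto simp: emeasure_point_measure_of emeasure_count_space_eq_0)

text \<open>The case of zero points in the Poisson formula. Support, law and independence of the bin
  minima are all derived from void events of this kind.\<close>

lemma prob_void:
  assumes "B \<in> sets borel" "emeasure \<mu> B = ennreal c" "c \<ge> 0"
  shows "prob {\<omega> \<in> space M. \<forall>i. (X i \<omega>, Y i \<omega>) \<notin> B} = exp (- c)"
proof -
  have m: "measure \<mu> B = c" using assms by (simp add: measure_def)
  have fin: "emeasure \<mu> B < \<infinity>" using assms by simp
  have "prob {\<omega> \<in> space M. emeasure (point_measure_of (\<lambda>i. X i \<omega>) (\<lambda>i. Y i \<omega>)) B = of_nat 0}
    = exp (- measure \<mu> B) * measure \<mu> B ^ 0 / fact 0"
    using ppp assms(1) fin unfolding poisson_point_process_def sets_intensity by blast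
  thus ?thesis using assms(1) m by (simp add: emeasure_points_eq_0_iff)
qed

lemma prob_void_disjoint:
  fixes J :: "nat set"
  assumes J: "finite J" "J \<noteq> {}" and B: "\<And>j. j \<in> J \<Longrightarrow> B j \<in> sets borel" and disj: "disjoint_family_on B J"
  shows "prob (\<Inter>j\<in>J. {\<omega> \<in> space M. \<forall>i. (X i \<omega>, Y i \<omega>) \<notin> B j})
    = (\<Prod>j\<in>J. prob {\<omega> \<in> space M. \<forall>i. (X i \<omega>, Y i \<omega>) \<notin> B j})"
proof -
  have *: "(\<lambda>\<omega>. emeasure (point_measure_of (\<lambda>i. X i \<omega>) (\<lambda>i. Y i \<omega>)) (B j)) -` {0} \<inter> space M
    = {\<omega> \<in> space M. \<forall>i. (X i \<omega>, Y i \<omega>) \<notin> B j}" if "j \<in> J" for j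
    using emeasure_points_eq_0_iff[OF B[OF that]] by auto
  have sub: "B ` J \<subseteq> sets \<mu>" using B by (auto simp: sets_intensity)
  have "indep_vars (\<lambda>_. borel) (\<lambda>j \<omega>. emeasure (point_measure_of (\<lambda>i. X i \<omega>) (\<lambda>i. Y i \<omega>)) (B j)) J"
    using ppp J(1) sub disj unfolding poisson_point_process_def by blast
  from indep_varsD_finite[OF this J(2,1), of "\<lambda>_. {0}"]
  have "prob (\<Inter>j\<in>J. (\<lambda>\<omega>. emeasure (point_measure_of (\<lambda>i. X i \<omega>) (\<lambda>i. Y i \<omega>)) (B j)) -` {0} \<inter> space M)
    = (\<Prod>j\<in>J. prob ((\<lambda>\<omega>. emeasure (point_measure_of (\<lambda>i. X i \<omega>) (\<lambda>i. Y i \<omega>)) (B j)) -` {0} \<inter> space M))"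
    by simp
  moreover have "(\<Inter>j\<in>J. (\<lambda>\<omega>. emeasure (point_measure_of (\<lambda>i. X i \<omega>) (\<lambda>i. Y i \<omega>)) (B j)) -` {0} \<inter> space M)
    = (\<Inter>j\<in>J. {\<omega> \<in> space M. \<forall>i. (X i \<omega>, Y i \<omega>) \<notin> B j})"
    by (rule INF_cong[OF refl *])
  moreover have "(\<Prod>j\<in>J. prob ((\<lambda>\<omega>. emeasure (point_measure_of (\<lambda>i. X i \<omega>) (\<lambda>i. Y i \<omega>)) (B j)) -` {0} \<inter> space M))
    = (\<Prod>j\<in>J. prob {\<omega> \<in> space M. \<forall>i. (X i \<omega>, Y i \<omega>) \<notin> B j})"
    by (rule prod.cong[OF refl]) (simp only: *)
  ultimately show ?thesis by simp
qed

text \<open>With values in the extended reals, \<open>c \<le> bin_min j\<close> is a void event also when the bin is empty.\<close>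

definition bin_min :: "nat \<Rightarrow> 'w \<Rightarrow> ereal" where
  "bin_min j \<omega> = (INF i. if X i \<omega> \<in> bin K j then ereal (Y i \<omega>) else \<infinity>)"

definition below :: "nat \<Rightarrow> ereal \<Rightarrow> (real \<times> real) set" where
  "below j c = {(x, y). x \<in> bin K j \<and> ereal y < c}"

lemma sets_below[measurable]: "below j c \<in> sets borel"
proof -
  have "{z \<in> space (borel \<Otimes>\<^sub>M borel). fst z \<in> bin K j \<and> ereal (snd z) < c} \<in> sets (borel \<Otimes>\<^sub>M borel)"
    by measurable
  thus ?thesis by (simp add: below_def borel_prod[symmetric] case_prod_beta' space_pair_measure)
qed

lemma le_bin_min_iff: "c \<le> bin_min j \<omega> \<longleftrightarrow> (\<forall>i. X i \<omega> \<in> bin K j \<longrightarrow> c \<le> ereal (Y i \<omega>))"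
  unfolding bin_min_def le_INF_iff by auto

lemma bin_min_ge_iff: "c \<le> bin_min j \<omega> \<longleftrightarrow> (\<forall>i. (X i \<omega>, Y i \<omega>) \<notin> below j c)"
  unfolding le_bin_min_iff by (auto simp: below_def not_less)

lemma measurable_bin_min[measurable]: "bin_min j \<in> borel_measurable M"
  unfolding bin_min_def by measurable

lemma bin_unique:
  assumes "x \<in> bin K i" "x \<in> bin K j" shows "i = j"
proof -
  have "real i - 1 \<le> x * K" "x * K < real i" "real j - 1 \<le> x * K" "x * K < real j"
    using assms K by (auto simp: bin_def field_simps)
  hence "real i < real j + 1" "real j < real i + 1" by linarith+
  thus ?thesis by linarith
qed

text \<open>The events \<open>c \<le> bin_min j \<omega>\<close> are void events of regions over
  disjoint bins, hence independent even with a different level for each bin. They are closed under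
  intersection, the larger level winning, and generate the sigma-algebra of the minimum.\<close>

lemma indep_bin_min: "indep_vars (\<lambda>_. borel) bin_min UNIV"
proof -
  define F where "F = (\<lambda>j. range (\<lambda>c::ereal. {\<omega> \<in> space M. c \<le> bin_min j \<omega>}))"
  have "indep_sets F UNIV"
  proof (rule indep_setsI)
    show "F j \<subseteq> events" for j unfolding F_def by auto
    fix A J assume J: "J \<noteq> {}" "finite J" "\<forall>j\<in>J. A j \<in> F j"
    have "\<forall>j\<in>J. \<exists>c. A j = {\<omega> \<in> space M. c \<le> bin_min j \<omega>}"
      using J(3) by (auto simp: F_def)
    from bchoice[OF this] obtain c where c: "\<And>j. j \<in> J \<Longrightarrow> A j = {\<omega> \<in> space M. c j \<le> bin_min j \<omega>}"
      by blast
    have A: "A j = {\<omega> \<in> space M. \<forall>i. (X i \<omega>, Y i \<omega>) \<notin> below j (c j)}" if "j \<in> J" for j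
      using c[OF that] by (simp add: bin_min_ge_iff)
    have "disjoint_family_on (\<lambda>j. below j (c j)) J"
      by (auto simp: disjoint_family_on_def below_def dest: bin_unique)
    note prob_void_disjoint[OF J(2,1) sets_below this]
    moreover have "(\<Inter>j\<in>J. A j) = (\<Inter>j\<in>J. {\<omega> \<in> space M. \<forall>i. (X i \<omega>, Y i \<omega>) \<notin> below j (c j)})"
      by (rule INF_cong[OF refl A])
    moreover have "(\<Prod>j\<in>J. prob (A j)) = (\<Prod>j\<in>J. prob {\<omega> \<in> space M. \<forall>i. (X i \<omega>, Y i \<omega>) \<notin> below j (c j)})"
      by (rule prod.cong[OF refl]) (simp only: A)
    ultimately show "prob (\<Inter>j\<in>J. A j) = (\<Prod>j\<in>J. prob (A j))" by simp
  qed
  moreover have "Int_stable (F j)" for j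
  proof (rule Int_stableI)
    fix a b assume "a \<in> F j" "b \<in> F j"
    then obtain c d where "a = {\<omega> \<in> space M. c \<le> bin_min j \<omega>}" "b = {\<omega> \<in> space M. d \<le> bin_min j \<omega>}"
      unfolding F_def by blast
    hence "a \<inter> b = {\<omega> \<in> space M. max c d \<le> bin_min j \<omega>}" by auto
    thus "a \<inter> b \<in> F j" unfolding F_def by blast
  qed
  ultimately have "indep_sets (\<lambda>j. sigma_sets (space M) (F j)) UNIV"
    by (rule indep_sets_sigma)
  hence "indep_sets (\<lambda>j. {bin_min j -` A \<inter> space M |A. A \<in> sets borel}) UNIV"
  proof (rule indep_sets_mono_sets)
    fix j
    have F: "F j \<subseteq> Pow (space M)" unfolding F_def by blast
    have "bin_min j \<in> borel_measurable (sigma (space M) (F j))"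
    proof (rule borel_measurableI_ge)
      fix c
      have "{\<omega> \<in> space M. c \<le> bin_min j \<omega>} \<in> F j" unfolding F_def by blast
      thus "{\<omega> \<in> space (sigma (space M) (F j)). c \<le> bin_min j \<omega>} \<in> sets (sigma (space M) (F j))"
        unfolding sets_measure_of[OF F] space_measure_of[OF F] by (rule sigma_sets.Basic)
    qed
    thus "{bin_min j -` A \<inter> space M |A. A \<in> sets borel} \<subseteq> sigma_sets (space M) (F j)"
      using measurable_sets[of "bin_min j" "sigma (space M) (F j)" borel]
      unfolding sets_measure_of[OF F] space_measure_of[OF F] by blast
  qed
  thus ?thesis unfolding indep_vars_def2 by simp
qed

section \<open>Distribution of a single bin minimum\<close>

definition epigraph :: "(real \<times> real) set" where
  "epigraph = {(x, y). x \<in> {0..1} \<and> x \<le> y}"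

lemma intensity_eq: "\<mu> = density lborel (\<lambda>z. ennreal (real n) * indicator epigraph z)"
  unfolding intensity_def epigraph_def using f by (intro arg_cong[where f="density lborel"] ext) (auto split: split_indicator)

lemma sets_epigraph[measurable]: "epigraph \<in> sets borel"
proof -
  have "{z \<in> space (borel \<Otimes>\<^sub>M borel). fst z \<in> {0..1::real} \<and> fst z \<le> snd z} \<in> sets (borel \<Otimes>\<^sub>M borel)"
    by measurable
  thus ?thesis by (simp add: epigraph_def borel_prod[symmetric] case_prod_beta' space_pair_measure)
qed

lemma emeasure_intensity:
  assumes [measurable]: "B \<in> sets borel"
  shows "emeasure \<mu> B = ennreal (real n) * emeasure lborel (B \<inter> epigraph)"
proof -
  have "emeasure \<mu> B = (\<integral>\<^sup>+z. ennreal (real n) * indicator (B \<inter> epigraph) z \<partial>lborel)"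
    unfolding intensity_eq by (subst emeasure_density) (auto intro!: nn_integral_cong split: split_indicator)
  thus ?thesis by (simp add: nn_integral_cmult)
qed

lemma AE_support: "AE \<omega> in M. \<forall>i. X i \<omega> \<in> {0..1} \<and> X i \<omega> \<le> Y i \<omega>"
proof -
  let ?B = "- epigraph"
  have B: "?B \<in> sets borel" using sets_epigraph by (rule borel_comp)
  have "emeasure \<mu> ?B = ennreal 0" by (simp add: emeasure_intensity[OF B])
  from prob_void[OF B this] have "prob {\<omega> \<in> space M. \<forall>i. (X i \<omega>, Y i \<omega>) \<notin> ?B} = 1" by simp
  hence "AE \<omega> in M. \<omega> \<in> {\<omega> \<in> space M. \<forall>i. (X i \<omega>, Y i \<omega>) \<notin> ?B}"
    \<comment> \<open>A set outside the sigma-algebra would have measure 0, so probability 1 already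
      entails that the event is measurable.\<close>
    by (subst AE_in_set_eq_1) (use measure_notin_sets in fastforce)+
  thus ?thesis by eventually_elim (auto simp: epigraph_def)
qed

abbreviation left_end :: "nat \<Rightarrow> real" where "left_end j \<equiv> (real j - 1) / real K"

text \<open>The area of the part of a bin between the boundary and the height \<open>s\<close> above its left end.\<close>

definition area :: "real \<Rightarrow> real" where
  "area s = (if s \<le> 1 / real K then s\<^sup>2 / 2 else s / real K - 1 / (2 * real K ^ 2))"

lemma emeasure_below:
  assumes j: "j \<in> {1..K}" and s: "s \<ge> 0"
  shows "emeasure \<mu> (below j (ereal (left_end j + s))) = ennreal (real n * area s)"
proof -
  define t where "t = left_end j"
  define c where "c = t + s"
  \<comment> \<open>The vertical slice over \<open>x\<close> is \<open>{x..<c}\<close> until either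
    the level or the right end of the bin is reached. The two cases become the two branches of
    \<open>area\<close>.\<close>
  define m where "m = min c (t + 1 / real K)"
  have K1: "1 / real K > 0" using K by simp
  have tm: "t \<le> m" "m \<le> c" using s K1 by (auto simp: m_def c_def)
  let ?S = "below j (ereal c) \<inter> epigraph"
  have S[measurable]: "?S \<in> sets (lborel \<Otimes>\<^sub>M lborel)"
    using sets.Int[OF sets_below sets_epigraph] by (simp only: lborel_prod sets_lborel)
  have bin: "bin K j = {t..<t + 1 / real K}"
    using K by (auto simp: bin_def t_def field_simps)
  have "emeasure lborel ?S = emeasure (lborel \<Otimes>\<^sub>M lborel) ?S" by (simp add: lborel_prod)
  also have "\<dots> = (\<integral>\<^sup>+x. emeasure lborel (Pair x -` ?S) \<partial>lborel)"
    by (rule lborel.emeasure_pair_measure_alt[OF S])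
  also have "\<dots> = (\<integral>\<^sup>+x. ennreal (c - x) * indicator {t..m} x \<partial>lborel)"
  proof (rule nn_integral_cong_AE)
    \<comment> \<open>The bin is half-open while the interval of integration is closed; they differ
      in the slice over the right end.\<close>
    have "AE x in lborel. x \<noteq> t + 1 / real K" by (rule AE_lborel_singleton)
    thus "AE x in lborel. emeasure lborel (Pair x -` ?S) = ennreal (c - x) * indicator {t..m} x"
    proof eventually_elim
      case (elim x)
      have "Pair x -` ?S = (if x \<in> {t..m} then {x..<c} else {})"
        using elim bin_subset[OF j, of x] unfolding below_def epigraph_def bin m_def by auto
      thus ?case using tm by (auto simp: indicator_def)
    qed
  qed
  also have "\<dots> = ennreal (- ((c - m)\<^sup>2 / 2) - - ((c - t)\<^sup>2 / 2))"
    using tm by (intro nn_integral_FTC_Icc)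
      (auto intro!: derivative_eq_intros simp: has_real_derivative_iff_has_vector_derivative[symmetric] field_simps)
  also have "- ((c - m)\<^sup>2 / 2) - - ((c - t)\<^sup>2 / 2) = area s"
    using K by (auto simp: m_def c_def area_def min_def power2_eq_square field_simps)
  finally show ?thesis
    using sets_below unfolding t_def[symmetric] c_def[symmetric]
    by (subst emeasure_intensity) (auto simp: ennreal_mult')
qed

lemma area_nonneg: "s \<ge> 0 \<Longrightarrow> area s \<ge> 0"
  using K by (auto simp: area_def field_simps power2_eq_square)

lemma prob_bin_min_ge:
  assumes "j \<in> {1..K}" "s \<ge> 0"
  shows "prob {\<omega> \<in> space M. ereal (left_end j + s) \<le> bin_min j \<omega>} = exp (- (real n * area s))"
  unfolding bin_min_ge_iff
  by (intro prob_void emeasure_below sets_below assms mult_nonneg_nonneg area_nonneg) simp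

text \<open>The line is the second branch of \<open>area\<close>, continued to the left as the
  tangent of the parabola at \<open>1 / K\<close>. The gap is \<open>(1 / K - s)^2 / 2\<close>;
  multiplied by \<open>K\<close> it is the deficit that later produces the bias.\<close>

lemma area_ge: 
  assumes "s \<ge> 0" shows "s / real K - 1 / (2 * real K ^ 2) \<le> area s"
proof -
  have "0 \<le> (s - 1 / real K)\<^sup>2" by simp
  thus ?thesis using K by (auto simp: area_def power2_eq_square field_simps)
qed

text \<open>An infinite minimum exceeds every level \<open>left_end j + k\<close>, and the
  probability of doing so decays exponentially in \<open>k\<close>.\<close>

lemma AE_bin_min_finite: "AE \<omega> in M. \<forall>j\<in>{1..K}. bin_min j \<omega> < \<infinity>"
proof -
  have "AE \<omega> in M. bin_min j \<omega> < \<infinity>" if j: "j \<in> {1..K}" for j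
  proof -
    let ?p = "prob {\<omega> \<in> space M. bin_min j \<omega> = \<infinity>}"
    have bd: "?p \<le> exp (1 / 2 * (real n / real K ^ 2) - real n / real K * real k)" for k
    proof -
      have "?p \<le> prob {\<omega> \<in> space M. ereal (left_end j + real k) \<le> bin_min j \<omega>}"
        by (intro finite_measure_mono) auto
      also have "\<dots> = exp (- (real n * area (real k)))" by (rule prob_bin_min_ge[OF j]) simp
      also have "\<dots> \<le> exp (- (real n * (real k / real K - 1 / (2 * real K ^ 2))))"
        by (simp add: area_ge mult_left_mono)
      also have "- (real n * (real k / real K - 1 / (2 * real K ^ 2))) = 1 / 2 * (real n / real K ^ 2) - real n / real K * real k"
        by (simp add: algebra_simps)
      finally show ?thesis .
    qed
    have lim0: "(\<lambda>k. exp (1 / 2 * (real n / real K ^ 2) - real n / real K * real k)) \<longlonglongrightarrow> 0"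
    proof -
      have lim: "(\<lambda>k. exp (b - c * real k)) \<longlonglongrightarrow> 0" if "c > 0" for b c :: real
        using that by real_asymp
      show ?thesis by (rule lim) (use n K in simp)
    qed
    have "?p \<le> 0"
      by (rule LIMSEQ_le_const[OF lim0]) (intro exI allI impI bd)
    hence "?p = 0" by (rule antisym[OF _ measure_nonneg])
    hence "AE \<omega> in M. \<not> bin_min j \<omega> = \<infinity>"
      by (subst (asm) prob_eq_0) auto
    thus ?thesis by eventually_elim (simp add: less_top[symmetric] top_ereal_def)
  qed
  thus ?thesis by (intro AE_finite_allI) simp_all
qed

section \<open>From extended minima to the coefficients of the estimator\<close>

abbreviation "h j \<omega> \<equiv> mle_coeff K (\<lambda>i. X i \<omega>) (\<lambda>i. Y i \<omega>) j"

text \<open>The almost sure event on which the real infimum in \<open>mle_coeff\<close> ranges over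
  a nonempty set bounded below and so agrees with \<open>bin_min\<close>. On it the data can be
  treated deterministically.\<close>

definition regular :: "'w \<Rightarrow> bool" where
  "regular \<omega> \<longleftrightarrow> (\<forall>i. X i \<omega> \<in> {0..1} \<and> X i \<omega> \<le> Y i \<omega>) \<and> (\<forall>j\<in>{1..K}. bin_min j \<omega> < \<infinity>)"

lemma AE_regular: "AE \<omega> in M. regular \<omega>"
  using AE_support AE_bin_min_finite unfolding regular_def by eventually_elim auto

lemma regular_bin:
  assumes reg: "regular \<omega>" and j: "j \<in> {1..K}"
  shows "{i. X i \<omega> \<in> bin K j} \<noteq> {}" and "bdd_below ((\<lambda>i. Y i \<omega>) ` {i. X i \<omega> \<in> bin K j})"
    and "ereal (h j \<omega>) = bin_min j \<omega>" and "left_end j \<le> h j \<omega>"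
proof -
  show ne: "{i. X i \<omega> \<in> bin K j} \<noteq> {}"
  proof
    assume "{i. X i \<omega> \<in> bin K j} = {}"
    hence "\<infinity> \<le> bin_min j \<omega>" unfolding le_bin_min_iff by auto
    thus False using reg j by (auto simp: regular_def)
  qed
  have lb: "left_end j \<le> Y i \<omega>" if "X i \<omega> \<in> bin K j" for i
  proof -
    have "left_end j \<le> X i \<omega>" using that by (simp add: bin_def)
    also have "\<dots> \<le> Y i \<omega>" using reg by (simp add: regular_def)
    finally show ?thesis .
  qed
  show bdd: "bdd_below ((\<lambda>i. Y i \<omega>) ` {i. X i \<omega> \<in> bin K j})"
    using lb by (intro bdd_belowI2[where m="left_end j"]) auto
  show "left_end j \<le> h j \<omega>"
    unfolding mle_coeff_def by (rule cINF_greatest[OF ne]) (use lb in auto)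
  have iff: "ereal c \<le> bin_min j \<omega> \<longleftrightarrow> c \<le> h j \<omega>" for c
    unfolding mle_coeff_def le_cINF_iff[OF ne bdd] by (simp add: le_bin_min_iff)
  have fin: "bin_min j \<omega> < \<infinity>" "bin_min j \<omega> \<ge> ereal (h j \<omega>)"
    using reg j iff[of "h j \<omega>"] by (auto simp: regular_def)
  then obtain b where b: "bin_min j \<omega> = ereal b" by (cases "bin_min j \<omega>") auto
  with iff[of b] iff[of "h j \<omega>"] show "ereal (h j \<omega>) = bin_min j \<omega>" by auto
qed

text \<open>Makes the likelihood a function of the minima. A point outside all bins, such as
  \<open>X = 1\<close>, meets the value 0 of the step function and is harmless since
  \<open>0 \<le> X \<le> Y\<close>.\<close>

lemma feasible_iff:
  assumes reg: "regular \<omega>"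
  shows "(\<forall>i. step_fun K a (X i \<omega>) \<le> Y i \<omega>) \<longleftrightarrow> (\<forall>j\<in>{1..K}. a j \<le> h j \<omega>)"
proof -
  have in_bin: "step_fun K a x = a j" if "j \<in> {1..K}" "x \<in> bin K j" for x j
  proof -
    have "step_fun K a x = (\<Sum>i=1..K. if i = j then a j else 0)"
      unfolding step_fun_def using that by (intro sum.cong) (auto simp: indicator_def dest: bin_unique)
    thus ?thesis using that by simp
  qed
  have out: "step_fun K a x = 0" if "\<forall>j\<in>{1..K}. x \<notin> bin K j" for x
    unfolding step_fun_def using that by (intro sum.neutral) auto
  have le: "a j \<le> h j \<omega> \<longleftrightarrow> (\<forall>i. X i \<omega> \<in> bin K j \<longrightarrow> a j \<le> Y i \<omega>)" if "j \<in> {1..K}" for j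
    unfolding mle_coeff_def le_cINF_iff[OF regular_bin(1,2)[OF reg that]] by auto
  show ?thesis
  proof
    assume *: "\<forall>i. step_fun K a (X i \<omega>) \<le> Y i \<omega>"
    show "\<forall>j\<in>{1..K}. a j \<le> h j \<omega>"
    proof
      fix j assume j: "j \<in> {1..K}"
      have "a j \<le> Y i \<omega>" if "X i \<omega> \<in> bin K j" for i
        using spec[OF *, of i] in_bin[OF j that] by simp
      thus "a j \<le> h j \<omega>" using le[OF j] by blast
    qed
  next
    assume a: "\<forall>j\<in>{1..K}. a j \<le> h j \<omega>"
    show "\<forall>i. step_fun K a (X i \<omega>) \<le> Y i \<omega>"
    proof
      fix i
      show "step_fun K a (X i \<omega>) \<le> Y i \<omega>"
      proof (cases "\<exists>j\<in>{1..K}. X i \<omega> \<in> bin K j")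
        case True
        then obtain j where j: "j \<in> {1..K}" "X i \<omega> \<in> bin K j" by blast
        hence "a j \<le> Y i \<omega>" using le[OF j(1)] a by blast
        thus ?thesis using in_bin[OF j] by simp
      next
        case False
        hence "step_fun K a (X i \<omega>) = 0" by (intro out) auto
        moreover have "0 \<le> X i \<omega>" "X i \<omega> \<le> Y i \<omega>" using reg unfolding regular_def by auto
        ultimately show ?thesis by simp
      qed
    qed
  qed
qed

text \<open>The infimum takes one constant value on the empty set and another on all sets unbounded below.\<close>

lemma measurable_mle_coeff[measurable]: "h j \<in> borel_measurable M"
proof -
  let ?e = "Inf {} :: real" and ?u = "Inf (UNIV :: real set)"
  have unb: "Inf S = ?u" if "\<not> bdd_below S" for S :: "real set"
  proof -
    have *: "\<not> bdd_below (UNIV :: real set)" using that bdd_below_mono[of UNIV S] by auto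
    \<comment> \<open>No real number bounds the negated set above, so the \<open>LEAST\<close> in
      the definition of the supremum is taken over an empty predicate, which is the same for all
      such \<open>T\<close>.\<close>
    have "Inf T = - (LEAST z::real. False)" if "\<not> bdd_below T" for T
    proof -
      have e: "(\<forall>x\<in>uminus ` T. x \<le> z) = False" for z :: real
      proof (unfold eq_False, rule notI)
        assume z: "\<forall>x\<in>uminus ` T. x \<le> z"
        have "bdd_below T" by (rule bdd_belowI[where m="- z"]) (use z in force)
        thus False using that by simp
      qed
      show ?thesis unfolding Inf_real_def Sup_real_def e ..
    qed
    from this[OF that] this[OF *] show ?thesis by simp
  qed
  have "h j \<omega> = (if bin_min j \<omega> = \<infinity> then ?e else if bin_min j \<omega> = - \<infinity> then ?u else real_of_ereal (bin_min j \<omega>))" for \<omega>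
  proof (cases "{i. X i \<omega> \<in> bin K j} = {}")
    case True
    hence "\<infinity> \<le> bin_min j \<omega>" unfolding le_bin_min_iff by auto
    hence "bin_min j \<omega> = \<infinity>" by simp
    thus ?thesis using True by (simp add: mle_coeff_def)
  next
    case ne: False
    then obtain i where "X i \<omega> \<in> bin K j" by auto
    hence "bin_min j \<omega> \<le> ereal (Y i \<omega>)"
      using le_bin_min_iff[of "bin_min j \<omega>" j \<omega>] by auto
    hence fin: "bin_min j \<omega> \<noteq> \<infinity>" by auto
    show ?thesis
    proof (cases "bdd_below ((\<lambda>i. Y i \<omega>) ` {i. X i \<omega> \<in> bin K j})")
      case bdd: True
      have iff: "ereal c \<le> bin_min j \<omega> \<longleftrightarrow> c \<le> h j \<omega>" for c
        unfolding mle_coeff_def le_cINF_iff[OF ne bdd] by (simp add: le_bin_min_iff)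
      have "bin_min j \<omega> \<ge> ereal (h j \<omega>)" by (simp add: iff)
      then obtain b where b: "bin_min j \<omega> = ereal b" using fin by (cases "bin_min j \<omega>") auto
      with iff[of b] iff[of "h j \<omega>"] show ?thesis by auto
    next
      case False
      have "bin_min j \<omega> \<noteq> ereal b" for b
      proof
        assume "bin_min j \<omega> = ereal b"
        hence "ereal b \<le> bin_min j \<omega>" by simp
        hence "\<forall>i. X i \<omega> \<in> bin K j \<longrightarrow> b \<le> Y i \<omega>" by (auto simp: le_bin_min_iff)
        thus False using False by (auto simp: bdd_below_def)
      qed
      hence "bin_min j \<omega> = - \<infinity>" using fin by (cases "bin_min j \<omega>") auto
      thus ?thesis using unb[OF False] by (simp add: mle_coeff_def)
    qed
  qed
  hence "h j = (\<lambda>\<omega>. if bin_min j \<omega> = \<infinity> then ?e else if bin_min j \<omega> = - \<infinity> then ?u else real_of_ereal (bin_min j \<omega>))"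
    by (rule ext)
  also have "\<dots> \<in> borel_measurable M" by measurable
  finally show ?thesis .
qed

lemma measurable_theta_mle[measurable]: "(\<lambda>\<omega>. theta_mle K (\<lambda>i. X i \<omega>) (\<lambda>i. Y i \<omega>)) \<in> borel_measurable M"
  unfolding theta_mle_def theta_step_fun[OF K] by measurable

end

section \<open>Total variation and credible intervals\<close>

lemma std_normal_atomless: "measure std_normal_distribution {x} = 0"
proof -
  have "emeasure std_normal_distribution {x} = (\<integral>\<^sup>+z. ennreal (std_normal_density z) * indicator {x} z \<partial>lborel)"
    by (subst emeasure_density) auto
  also have "\<dots> = (\<integral>\<^sup>+z. 0 \<partial>(lborel :: real measure))"
  proof (rule nn_integral_cong_AE)
    show "AE z in lborel. ennreal (std_normal_density z) * indicator {x} z = 0"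
      using AE_lborel_singleton[of x] by eventually_elim auto
  qed
  finally show ?thesis by (simp add: measure_def)
qed

text \<open>\<open>inv\<close> inverts from the right on the range of the distribution function. The
  level \<open>p\<close> lies in this range by the intermediate value theorem, continuity coming
  from the absence of atoms.\<close>

lemma cdf_normal_quantile:
  assumes p: "0 < p" "p < 1"
  shows "cdf std_normal_distribution (normal_quantile p) = p"
proof -
  interpret real_distribution std_normal_distribution by (rule real_dist_normal_dist)
  let ?F = "cdf std_normal_distribution"
  have cont: "continuous_on S ?F" for S
    using isCont_cdf std_normal_atomless by (auto intro!: continuous_at_imp_continuous_on)
  have "\<forall>\<^sub>F x in at_bot. ?F x < p"
    by (rule order_tendstoD(2)[OF cdf_lim_at_bot p(1)])
  then obtain a where a: "\<And>x. x \<le> a \<Longrightarrow> ?F x < p" by (auto simp: eventually_at_bot_linorder)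
  have "\<forall>\<^sub>F x in at_top. ?F x > p"
    by (rule order_tendstoD(1)[OF cdf_lim_at_top_prob p(2)])
  then obtain b where b: "\<And>x. x \<ge> b \<Longrightarrow> ?F x > p" by (auto simp: eventually_at_top_linorder)
  have "\<exists>x. a \<le> x \<and> x \<le> max a b \<and> ?F x = p"
    by (rule IVT') (use a[of a] b[of "max a b"] cont in auto)
  hence "p \<in> range ?F" by auto
  thus ?thesis unfolding normal_quantile_def by (rule f_inv_into_f)
qed

lemma normal_quantile_less:
  assumes "0 < p" "p < q" "q < 1" shows "normal_quantile p < normal_quantile q"
proof (rule ccontr)
  interpret real_distribution std_normal_distribution by (rule real_dist_normal_dist)
  assume "\<not> normal_quantile p < normal_quantile q"
  hence "cdf std_normal_distribution (normal_quantile q) \<le> cdf std_normal_distribution (normal_quantile p)"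
    by (intro cdf_nondecreasing) auto
  thus False using assms cdf_normal_quantile[of p] cdf_normal_quantile[of q] by simp
qed

lemma normal_law_quantile_interval:
  assumes s: "s > 0" and \<alpha>: "0 < \<alpha>" "\<alpha> < 1"
  shows "measure (normal_law m (s\<^sup>2)) {m + s * normal_quantile (\<alpha> / 2) .. m + s * normal_quantile (1 - \<alpha> / 2)} = 1 - \<alpha>"
proof -
  interpret real_distribution std_normal_distribution by (rule real_dist_normal_dist)
  let ?a = "normal_quantile (\<alpha> / 2)" and ?b = "normal_quantile (1 - \<alpha> / 2)"
  have ab: "?a < ?b" using \<alpha> by (intro normal_quantile_less) auto
  have "distributed std_normal_distribution lborel (\<lambda>x. x) std_normal_density"
    unfolding distributed_def by (auto simp: distr_id2)
  hence "distributed std_normal_distribution lborel (\<lambda>x. m + s * x) (normal_density (m + s * 0) (\<bar>s\<bar> * 1))"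
    using s by (intro normal_density_affine) auto
  hence "normal_law m (s\<^sup>2) = distr std_normal_distribution lborel (\<lambda>x. m + s * x)"
    using s by (simp add: normal_law_def distributed_distr_eq_density)
  moreover have "measure (distr std_normal_distribution lborel (\<lambda>x. m + s * x)) {m + s * ?a .. m + s * ?b}
      = prob ((\<lambda>x. m + s * x) -` {m + s * ?a .. m + s * ?b} \<inter> space std_normal_distribution)"
    by (rule measure_distr) auto
  ultimately have "measure (normal_law m (s\<^sup>2)) {m + s * ?a .. m + s * ?b} = prob ((\<lambda>x. m + s * x) -` {m + s * ?a .. m + s * ?b} \<inter> UNIV)"
    by simp
  \<comment> \<open>The distribution function measures half-open intervals; the left end point is
    split off as a null set.\<close>
  also have "(\<lambda>x. m + s * x) -` {m + s * ?a .. m + s * ?b} \<inter> UNIV = {?a} \<union> {?a<..?b}"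
    using s ab by auto
  also have "prob \<dots> = prob {?a} + prob {?a<..?b}"
    by (intro finite_measure_Union) auto
  also have "\<dots> = cdf std_normal_distribution ?b - cdf std_normal_distribution ?a"
    using cdf_diff_eq[OF ab] by (simp add: std_normal_atomless)
  also have "\<dots> = 1 - \<alpha>"
    using \<alpha> cdf_normal_quantile[of "\<alpha> / 2"] cdf_normal_quantile[of "1 - \<alpha> / 2"] by simp
  finally show ?thesis .
qed

lemma sigma_finite_param_space: "sigma_finite_measure (param_space K)"
  unfolding param_space_def
  by (intro product_sigma_finite.sigma_finite product_sigma_finite.intro sigma_finite_lborel) simp

context prob_space
begin

text \<open>A non-integrable \<open>g\<close> has expectation 0.\<close>

lemma expectation_le_good_event:
  assumes g: "\<And>\<omega>. 0 \<le> g \<omega>" "\<And>\<omega>. g \<omega> \<le> 1" and d: "d \<ge> 0" and bad[measurable]: "bad \<in> events"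
    and good: "AE \<omega> in M. \<omega> \<notin> bad \<longrightarrow> g \<omega> \<le> d"
  shows "0 \<le> expectation g" and "expectation g \<le> d + prob bad"
proof -
  show "0 \<le> expectation g" using g by (intro integral_nonneg_AE) auto
  show "expectation g \<le> d + prob bad"
  proof (cases "integrable M g")
    case True
    have "expectation g \<le> expectation (\<lambda>\<omega>. d + indicator bad \<omega>)"
    proof (rule integral_mono_AE[OF True])
      show "AE \<omega> in M. g \<omega> \<le> d + indicator bad \<omega>"
        using good
      proof eventually_elim
        case (elim \<omega>)
        thus ?case using g(2)[of \<omega>] d by (auto simp: indicator_def)
      qed
      show "integrable M (\<lambda>\<omega>. d + indicator bad \<omega>)"
        by (rule integrable_const_bound[where B="d + 1"]) (use d in \<open>auto simp: indicator_def\<close>)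
    qed
    also have "\<dots> = d + prob bad"
      using integrable_real_indicator[OF bad] by (simp add: prob_space less_top[symmetric])
    finally show ?thesis .
  qed (use d in \<open>simp add: not_integrable_integral_eq\<close>)
qed

end

section \<open>Posterior approximation for random data\<close>

context boundary_sample
begin

lemma prob_bin_min_large:
  assumes R: "R \<ge> 1"
  shows "prob {\<omega> \<in> space M. \<exists>j\<in>{1..K}. ereal R \<le> bin_min j \<omega>} \<le> real K * exp (- (real n / real K * (R - 1)))"
proof -
  have "prob {\<omega> \<in> space M. \<exists>j\<in>{1..K}. ereal R \<le> bin_min j \<omega>} = prob (\<Union>j\<in>{1..K}. {\<omega> \<in> space M. ereal R \<le> bin_min j \<omega>})"
    by (intro arg_cong[where f=prob]) auto
  also have "\<dots> \<le> (\<Sum>j\<in>{1..K}. prob {\<omega> \<in> space M. ereal R \<le> bin_min j \<omega>})"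
    by (intro finite_measure_subadditive_finite) auto
  also have "\<dots> \<le> (\<Sum>j\<in>{1..K}. exp (- (real n / real K * (R - 1))))"
  proof (rule sum_mono)
    fix j assume j: "j \<in> {1..K}"
    define s where "s = R - left_end j"
    \<comment> \<open>The last bin starts a full width before 1. This additional
      \<open>1 / K\<close> in \<open>s\<close> pays for the term \<open>1 / (2 K^2)\<close> lost in
      \<open>area_ge\<close>.\<close>
    have "left_end j \<le> 1 - 1 / real K" using j K by (simp add: field_simps)
    hence s1: "s \<ge> R - 1 + 1 / real K" by (simp add: s_def)
    moreover have "0 \<le> 1 / real K" by simp
    ultimately have s: "s \<ge> 0" using R by linarith
    have "(R - 1) / real K \<le> (R - 1 + 1 / real K) / real K - 1 / (2 * real K ^ 2)"
      using K by (simp add: field_simps power2_eq_square)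
    also have "\<dots> \<le> s / real K - 1 / (2 * real K ^ 2)"
      using s1 by (intro diff_right_mono divide_right_mono) auto
    also have "\<dots> \<le> area s" by (rule area_ge[OF s])
    finally have "real n * ((R - 1) / real K) \<le> real n * area s" by (intro mult_left_mono) auto
    moreover have "prob {\<omega> \<in> space M. ereal R \<le> bin_min j \<omega>} = exp (- (real n * area s))"
      using prob_bin_min_ge[OF j s] by (simp add: s_def)
    ultimately show "prob {\<omega> \<in> space M. ereal R \<le> bin_min j \<omega>} \<le> exp (- (real n / real K * (R - 1)))"
      by simp
  qed
  finally show ?thesis by simp
qed

abbreviation "mle \<omega> \<equiv> theta_mle K (\<lambda>i. X i \<omega>) (\<lambda>i. Y i \<omega>)"
abbreviation "post R \<omega> \<equiv> posterior_theta n K R (\<lambda>i. X i \<omega>) (\<lambda>i. Y i \<omega>)"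
abbreviation "limit_law \<omega> \<equiv> normal_law (mle \<omega> - real K / real n) (real K / real n ^ 2)"
abbreviation "bad R \<equiv> {\<omega> \<in> space M. \<exists>j\<in>{1..K}. ereal R \<le> bin_min j \<omega>}"

text \<open>Error of the Gamma approximation plus the mass cut off at \<open>- R\<close>; it does
  not depend on the sample.\<close>

definition tv_bound :: "real \<Rightarrow> real" where
  "tv_bound R = normal_approx_error K + real K * exp (- (real n / real K * R))"

lemma tv_bound_nonneg: "tv_bound R \<ge> 0"
  by (simp add: tv_bound_def normal_approx_error_def)

lemma posterior_approx:
  assumes R: "R > 0" and reg: "regular \<omega>" and \<omega>: "\<omega> \<in> space M" "\<omega> \<notin> bad R" and B: "B \<in> sets borel"
  shows "\<bar>measure (post R \<omega>) B - measure (limit_law \<omega>) B\<bar> \<le> tv_bound R"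
  unfolding theta_mle_def theta_step_fun[OF K] tv_bound_def
proof (rule posterior_theta_normal_approx[OF n K R _ feasible_iff[OF reg] B])
  fix j assume j: "j \<in> {1..K}"
  have "0 \<le> left_end j" using j by simp
  also have "\<dots> \<le> h j \<omega>" by (rule regular_bin(4)[OF reg j])
  finally have "0 \<le> h j \<omega>" .
  moreover have "bin_min j \<omega> < ereal R" using \<omega> j by (auto simp: not_le)
  hence "h j \<omega> < R" using regular_bin(3)[OF reg j] by (metis less_ereal.simps(1))
  ultimately show "0 \<le> h j \<omega> \<and> h j \<omega> \<le> R" by simp
qed

lemma prob_space_limit_law: "prob_space (limit_law \<omega>)"
  using n K by (intro prob_space_normal_law) simp

text \<open>The bounds 0 and 1 hold at every sample point because the posterior has mass at most 1
  throughout; they take care of the bad event.\<close>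

lemma tv_dist_bounds:
  shows "0 \<le> tv_dist (post R \<omega>) (limit_law \<omega>)" and "tv_dist (post R \<omega>) (limit_law \<omega>) \<le> 1"
    and "R > 0 \<Longrightarrow> regular \<omega> \<Longrightarrow> \<omega> \<in> space M \<Longrightarrow> \<omega> \<notin> bad R \<Longrightarrow> tv_dist (post R \<omega>) (limit_law \<omega>) \<le> tv_bound R"
proof -
  interpret N: prob_space "limit_law \<omega>" by (rule prob_space_limit_law)
  have le1: "\<bar>measure (post R \<omega>) B - measure (limit_law \<omega>) B\<bar> \<le> 1" for B
    using measure_posterior_theta_le_1[OF K, of n R "\<lambda>i. X i \<omega>" "\<lambda>i. Y i \<omega>" B] N.prob_le_1[of B]
      measure_nonneg[of "post R \<omega>" B] measure_nonneg[of "limit_law \<omega>" B] by linarith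
  have "\<bar>measure (post R \<omega>) {} - measure (limit_law \<omega>) {}\<bar> \<le> tv_dist (post R \<omega>) (limit_law \<omega>)"
    unfolding tv_dist_def by (rule cSUP_upper) (auto intro!: bdd_aboveI2[where M=1] le1)
  thus "0 \<le> tv_dist (post R \<omega>) (limit_law \<omega>)" by simp
  show "tv_dist (post R \<omega>) (limit_law \<omega>) \<le> 1"
    unfolding tv_dist_def by (rule cSUP_least) (auto intro: le1)
  show "tv_dist (post R \<omega>) (limit_law \<omega>) \<le> tv_bound R" if "R > 0" "regular \<omega>" "\<omega> \<in> space M" "\<omega> \<notin> bad R"
  proof -
    have "sets (post R \<omega>) = sets borel" by (simp add: posterior_theta_def)
    thus ?thesis unfolding tv_dist_def by (intro cSUP_least posterior_approx[OF that]) auto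
  qed
qed

lemma expectation_tv_dist:
  assumes "R > 1"
  shows "0 \<le> expectation (\<lambda>\<omega>. tv_dist (post R \<omega>) (limit_law \<omega>))"
    and "expectation (\<lambda>\<omega>. tv_dist (post R \<omega>) (limit_law \<omega>)) \<le> tv_bound R + real K * exp (- (real n / real K * (R - 1)))"
proof -
  have bad: "bad R \<in> events" by measurable
  have "AE \<omega> in M. \<omega> \<notin> bad R \<longrightarrow> tv_dist (post R \<omega>) (limit_law \<omega>) \<le> tv_bound R"
    using AE_regular AE_space
  proof eventually_elim
    case (elim \<omega>) thus ?case using assms tv_dist_bounds(3)[of R \<omega>] by auto
  qed
  note * = expectation_le_good_event[OF tv_dist_bounds(1,2) tv_bound_nonneg bad this]
  show "0 \<le> expectation (\<lambda>\<omega>. tv_dist (post R \<omega>) (limit_law \<omega>))" by (rule *(1))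
  show "expectation (\<lambda>\<omega>. tv_dist (post R \<omega>) (limit_law \<omega>)) \<le> tv_bound R + real K * exp (- (real n / real K * (R - 1)))"
    using *(2) prob_bin_min_large[of R] assms by simp
qed

abbreviation "CI \<alpha> \<omega> \<equiv> credible_interval n K (\<lambda>i. X i \<omega>) (\<lambda>i. Y i \<omega>) \<alpha>"

lemma limit_law_CI:
  assumes "0 < \<alpha>" "\<alpha> < 1"
  shows "measure (limit_law \<omega>) (CI \<alpha> \<omega>) = 1 - \<alpha>"
proof -
  have "real K / real n ^ 2 = (sqrt (real K) / real n)\<^sup>2" by (simp add: power_divide)
  thus ?thesis unfolding credible_interval_def
    using n K assms by (simp only:) (intro normal_law_quantile_interval, auto)
qed

text \<open>For the total variation distance the default value 0 of a non-integrable expectation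
  agrees with the limit. Here the limit is \<open>1 - \<alpha>\<close>, so genuine integrability is
  required. The interval moves with the sample, hence numerator and denominator are handled as
  parameter integrals.\<close>

lemma measurable_post_CI: "(\<lambda>\<omega>. measure (post R \<omega>) (CI \<alpha> \<omega>)) \<in> borel_measurable M"
proof -
  interpret P: sigma_finite_measure "param_space K" by (rule sigma_finite_param_space)
  have [measurable]: "(\<lambda>z. posterior_weight n K R (\<lambda>i. X i (fst z)) (\<lambda>i. Y i (fst z)) (snd z)) \<in> borel_measurable (M \<Otimes>\<^sub>M param_space K)"
    by (rule measurable_posterior_weight[OF K]) measurable
  have [measurable]: "(\<lambda>z. mle (fst z)) \<in> borel_measurable (M \<Otimes>\<^sub>M param_space K)"
    by (rule measurable_compose[OF measurable_fst measurable_theta_mle])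
  have window: "(\<lambda>z. ennreal (w z) * (if m z - c + a \<le> t z \<and> t z \<le> m z - c + b then 1 else 0)) \<in> borel_measurable N"
    if [measurable]: "w \<in> borel_measurable N" "m \<in> borel_measurable N" "t \<in> borel_measurable N"
    for w m t and a b c :: real and N :: "('w \<times> (nat \<Rightarrow> real)) measure"
    by measurable
  have ind: "(indicator (CI \<alpha> \<omega>) t :: ennreal) =
    (if mle \<omega> - real K / real n + sqrt (real K) / real n * normal_quantile (\<alpha> / 2) \<le> t \<and>
        t \<le> mle \<omega> - real K / real n + sqrt (real K) / real n * normal_quantile (1 - \<alpha> / 2) then 1 else 0)" for \<omega> t
    by (simp add: credible_interval_def indicator_def)
  have "(\<lambda>\<omega>. \<integral>\<^sup>+a. ennreal (posterior_weight n K R (\<lambda>i. X i \<omega>) (\<lambda>i. Y i \<omega>) a) *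
     indicator (CI \<alpha> \<omega>) ((\<Sum>j=1..K. a j) / real K) \<partial>param_space K) \<in> borel_measurable M"
    unfolding ind by (rule P.borel_measurable_nn_integral, unfold case_prod_beta') (rule window, measurable)
  moreover have "(\<lambda>\<omega>. \<integral>\<^sup>+a. ennreal (posterior_weight n K R (\<lambda>i. X i \<omega>) (\<lambda>i. Y i \<omega>) a) \<partial>param_space K) \<in> borel_measurable M"
    by (rule P.borel_measurable_nn_integral) (simp add: case_prod_beta')
  moreover have "CI \<alpha> \<omega> \<in> sets borel" for \<omega> by (simp add: credible_interval_def)
  ultimately show ?thesis
    unfolding measure_def by (subst emeasure_posterior_theta[OF K]) auto
qed

lemma expectation_credible:
  assumes R: "R > 1" and \<alpha>: "0 < \<alpha>" "\<alpha> < 1"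
  shows "\<bar>expectation (\<lambda>\<omega>. measure (post R \<omega>) (CI \<alpha> \<omega>)) - (1 - \<alpha>)\<bar>
    \<le> tv_bound R + real K * exp (- (real n / real K * (R - 1)))"
proof -
  note [measurable] = measurable_post_CI
  have bad: "bad R \<in> events" by measurable
  let ?g = "\<lambda>\<omega>. measure (post R \<omega>) (CI \<alpha> \<omega>) - (1 - \<alpha>)"
  have le: "measure (post R \<omega>) (CI \<alpha> \<omega>) \<le> 1" for \<omega> by (rule measure_posterior_theta_le_1[OF K])
  have int: "integrable M (\<lambda>\<omega>. measure (post R \<omega>) (CI \<alpha> \<omega>))"
    by (rule integrable_const_bound[where B=1]) (auto simp: le)
  have g1: "\<bar>?g \<omega>\<bar> \<le> 1" for \<omega> using le[of \<omega>] \<alpha> measure_nonneg[of "post R \<omega>" "CI \<alpha> \<omega>"] by linarith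
  have "AE \<omega> in M. \<omega> \<notin> bad R \<longrightarrow> \<bar>?g \<omega>\<bar> \<le> tv_bound R"
    using AE_regular AE_space
  proof eventually_elim
    case (elim \<omega>)
    have "CI \<alpha> \<omega> \<in> sets borel" by (simp add: credible_interval_def)
    thus ?case using posterior_approx[of R \<omega> "CI \<alpha> \<omega>"] elim R limit_law_CI[OF \<alpha>, of \<omega>] by auto
  qed
  from expectation_le_good_event(2)[OF abs_ge_zero g1 tv_bound_nonneg bad this]
  have "expectation (\<lambda>\<omega>. \<bar>?g \<omega>\<bar>) \<le> tv_bound R + prob (bad R)" .
  moreover have "\<bar>expectation ?g\<bar> \<le> expectation (\<lambda>\<omega>. \<bar>?g \<omega>\<bar>)" by (rule integral_abs_bound)
  moreover have "expectation ?g = expectation (\<lambda>\<omega>. measure (post R \<omega>) (CI \<alpha> \<omega>)) - (1 - \<alpha>)"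
    using int by (simp add: prob_space)
  ultimately show ?thesis using prob_bin_min_large[of R] R by simp
qed

end

section \<open>Bias of the maximum likelihood estimator\<close>

text \<open>Puts the radius into the scale \<open>v / K\<close> of the bias, with
  \<open>v = min 1 (n / K^2)\<close>; here 256 is \<open>2 ^ 8\<close>. For \<open>n = 0\<close>
  both sides vanish.\<close>

lemma sqrt_mult_rho:
  assumes "K > 0"
  shows "sqrt (real K) / real n * rho n K = min 1 (real n / real K ^ 2) / (256 * real K)"
proof (cases "n = 0")
  case False
  have K: "real K > 0" using assms by simp
  have a: "sqrt (real K) * real K powr (-3/2) = 1 / real K"
  proof -
    have "sqrt (real K) * real K powr (-3/2) = real K powr (1 / 2 + (-3/2))"
      unfolding powr_add using K by (simp add: powr_half_sqrt)
    thus ?thesis using K by (simp add: powr_neg_one)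
  qed
  have b: "sqrt (real K) * real K powr (-7/2) = 1 / real K ^ 3"
  proof -
    have "sqrt (real K) * real K powr (-7/2) = real K powr (1 / 2 + (-7/2))"
      unfolding powr_add using K by (simp add: powr_half_sqrt)
    also have "\<dots> = 1 / real K powr (real 3)" by (simp add: powr_minus_divide)
    also have "real K powr (real 3) = real K ^ 3" using K by (rule powr_realpow)
    finally show ?thesis .
  qed
  have "sqrt (real K) / real n * rho n K =
      1 / 2 ^ 8 * (sqrt (real K) / real n * min (real n * real K powr (-3/2)) (real n ^ 2 * real K powr (-7/2)))"
    by (simp add: rho_def)
  also have "sqrt (real K) / real n * min (real n * real K powr (-3/2)) (real n ^ 2 * real K powr (-7/2)) =
      min (sqrt (real K) / real n * (real n * real K powr (-3/2))) (sqrt (real K) / real n * (real n ^ 2 * real K powr (-7/2)))"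
    by (intro min_mult_distrib_left[THEN trans]) auto
  also have "sqrt (real K) / real n * (real n * real K powr (-3/2)) = sqrt (real K) * real K powr (-3/2)"
    using False by simp
  also have "sqrt (real K) / real n * (real n ^ 2 * real K powr (-7/2)) = real n * (sqrt (real K) * real K powr (-7/2))"
    using False by (simp add: power2_eq_square)
  also have "min (sqrt (real K) * real K powr (-3/2)) (real n * (sqrt (real K) * real K powr (-7/2)))
      = min (1 * (1 / real K)) (real n / real K ^ 2 * (1 / real K))"
    unfolding a b by (simp add: power2_eq_square power3_eq_cube)
  also have "\<dots> = min 1 (real n / real K ^ 2) * (1 / real K)"
    using K by (subst min_mult_distrib_right) auto
  finally show ?thesis by simp
qed (simp add: rho_def)

lemma sum_left_ends:
  assumes "K > 0" shows "(\<Sum>j=1..K. (real j - 1) / real K) = (real K - 1) / 2"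
proof -
  have "(\<Sum>j=1..m. real j - 1) = real m * (real m - 1) / 2" for m
    by (induction m) (auto simp: field_simps)
  thus ?thesis using assms by (simp flip: sum_divide_distrib)
qed

section \<open>Waiting times, early bins and the error of the estimator\<close>

context boundary_sample
begin

text \<open>The branches meet at \<open>1 / (2 K^2)\<close>, the value of \<open>area\<close> at
  \<open>1 / K\<close>.\<close>

definition area_inv :: "real \<Rightarrow> real" where
  "area_inv u = (if u \<le> 1 / (2 * real K ^ 2) then sqrt (2 * u) else real K * u + 1 / (2 * real K))"

lemma area_inv:
  assumes u: "u \<ge> 0"
  shows "area_inv u \<ge> 0" and "area (area_inv u) = u"
    and "s \<ge> 0 \<Longrightarrow> u \<le> area s \<longleftrightarrow> area_inv u \<le> s"
proof -
  have K0: "real K > 0" using K by simp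
  show "area_inv u \<ge> 0" using u by (simp add: area_inv_def)
  have sq: "sqrt (2 * u) \<le> 1 / real K \<longleftrightarrow> u \<le> 1 / (2 * real K ^ 2)"
  proof -
    have "sqrt ((1 / real K)\<^sup>2) = 1 / real K" using K0 by simp
    hence "sqrt (2 * u) \<le> 1 / real K \<longleftrightarrow> 2 * u \<le> (1 / real K)\<^sup>2"
      using real_sqrt_le_iff[of "2 * u" "(1 / real K)\<^sup>2"] by simp
    thus ?thesis using K0 by (simp add: power_divide field_simps)
  qed
  have lin: "real K * u + 1 / (2 * real K) \<le> 1 / real K \<longleftrightarrow> u \<le> 1 / (2 * real K ^ 2)"
    using K0 by (simp add: field_simps power2_eq_square)
  show "area (area_inv u) = u"
  proof (cases "u \<le> 1 / (2 * real K ^ 2)")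
    case True thus ?thesis using u sq by (simp add: area_def area_inv_def)
  next
    case False thus ?thesis using lin K0 by (simp add: area_def area_inv_def field_simps power2_eq_square)
  qed
  show "u \<le> area s \<longleftrightarrow> area_inv u \<le> s" if s: "s \<ge> 0"
  proof (cases "s \<le> 1 / real K")
    case True
    have s2: "s\<^sup>2 \<le> (1 / real K)\<^sup>2" using True s by (intro power_mono) auto
    show ?thesis
    proof (cases "u \<le> 1 / (2 * real K ^ 2)")
      case u1: True
      have "sqrt (2 * u) \<le> s \<longleftrightarrow> 2 * u \<le> s\<^sup>2" using s u by (metis real_sqrt_le_iff real_sqrt_unique abs_of_nonneg real_sqrt_abs)
      thus ?thesis using True u1 by (simp add: area_def area_inv_def mult.commute[of u 2])
    next
      case u1: False
      have "area s \<le> 1 / (2 * real K ^ 2)" using True s2 by (simp add: area_def power_divide)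
      moreover have "area_inv u > 1 / real K" using u1 lin by (simp add: area_inv_def)
      ultimately show ?thesis using u1 True by linarith
    qed
  next
    case False
    show ?thesis
    proof (cases "u \<le> 1 / (2 * real K ^ 2)")
      case u1: True
      have "area_inv u \<le> 1 / real K" using u1 sq by (simp add: area_inv_def)
      moreover have "area s \<ge> 1 / (2 * real K ^ 2)"
        using False K0 by (simp add: area_def field_simps power2_eq_square)
      ultimately show ?thesis using u1 False by linarith
    next
      case u1: False
      thus ?thesis using False K0 by (simp add: area_def area_inv_def field_simps power2_eq_square)
    qed
  qed
qed

lemma measurable_area[measurable]: "area \<in> borel_measurable borel"
  unfolding area_def[abs_def] by measurable

text \<open>On the scale of intensity, the minimum of a bin is a standard exponential waiting time.\<close>

definition waiting :: "nat \<Rightarrow> 'w \<Rightarrow> real" where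
  "waiting j \<omega> = real n * area (real_of_ereal (bin_min j \<omega>) - left_end j)"

lemma measurable_waiting[measurable]: "waiting j \<in> borel_measurable M"
  unfolding waiting_def[abs_def] by measurable

text \<open>Probability integral transform: \<open>area_inv\<close> translates the level of the
  waiting time into a level of the minimum, up to a null set.\<close>

lemma prob_waiting_ge:
  assumes j: "j \<in> {1..K}" and t: "t \<ge> 0"
  shows "prob {\<omega> \<in> space M. t \<le> waiting j \<omega>} = exp (- t)"
proof -
  define s where "s = area_inv (t / real n)"
  have tn: "t / real n \<ge> 0" using t by simp
  have "prob {\<omega> \<in> space M. t \<le> waiting j \<omega>} = prob {\<omega> \<in> space M. ereal (left_end j + s) \<le> bin_min j \<omega>}"
  proof (rule measure_eq_AE)
    show "AE \<omega> in M. \<omega> \<in> {\<omega> \<in> space M. t \<le> waiting j \<omega>} \<longleftrightarrow> \<omega> \<in> {\<omega> \<in> space M. ereal (left_end j + s) \<le> bin_min j \<omega>}"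
      using AE_regular
    proof eventually_elim
      case (elim \<omega>)
      have b: "bin_min j \<omega> = ereal (h j \<omega>)" using regular_bin(3)[OF elim j] by simp
      have "t \<le> waiting j \<omega> \<longleftrightarrow> t / real n \<le> area (h j \<omega> - left_end j)"
        using n by (simp add: waiting_def b field_simps)
      also have "\<dots> \<longleftrightarrow> left_end j + s \<le> h j \<omega>"
        using area_inv(3)[OF tn, of "h j \<omega> - left_end j"] regular_bin(4)[OF elim j] by (auto simp: s_def)
      finally show ?case by (simp add: b)
    qed
  qed measurable
  also have "\<dots> = exp (- (real n * area s))"
    by (rule prob_bin_min_ge[OF j]) (simp add: s_def area_inv(1)[OF tn])
  also have "real n * area s = t" using n by (simp add: s_def area_inv(2)[OF tn])
  finally show ?thesis .
qed

text \<open>Void events give the probability of \<open>a \<le> waiting j \<omega>\<close>, whereas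
  the distribution function needs the strict inequality. The latter is squeezed between the levels
  \<open>a\<close> and \<open>a + 1 / (k + 1)\<close>.\<close>

lemma waiting_exponential:
  assumes j: "j \<in> {1..K}"
  shows "distributed M lborel (waiting j) (exponential_density 1)"
proof (rule exponential_distributed_iff[OF zero_less_one, THEN iffD2], intro conjI allI impI)
  fix a :: real assume a: "0 \<le> a"
  let ?p = "prob {\<omega> \<in> space M. a < waiting j \<omega>}"
  have u: "?p \<le> exp (- a)"
  proof -
    have "?p \<le> prob {\<omega> \<in> space M. a \<le> waiting j \<omega>}" by (intro finite_measure_mono) auto
    thus ?thesis by (simp add: prob_waiting_ge[OF j a])
  qed
  have l: "exp (- (a + inverse (real (Suc k)))) \<le> ?p" for k
  proof -
    define i where "i = inverse (real (Suc k))"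
    have i: "0 < i" by (simp add: i_def)
    hence "prob {\<omega> \<in> space M. a + i \<le> waiting j \<omega>} \<le> ?p"
      by (intro finite_measure_mono) auto
    moreover have "prob {\<omega> \<in> space M. a + i \<le> waiting j \<omega>} = exp (- (a + i))"
      using a i by (intro prob_waiting_ge[OF j]) simp
    ultimately show ?thesis by (simp only: i_def)
  qed
  have "(\<lambda>k. exp (- (a + inverse (real (Suc k))))) \<longlonglongrightarrow> exp (- (a + 0))"
    by (intro tendsto_intros LIMSEQ_inverse_real_of_nat)
  hence "exp (- (a + 0)) \<le> ?p" by (rule LIMSEQ_le_const2) (intro exI allI impI l)
  hence "?p = exp (- a)" using u by simp
  moreover have "prob {\<omega> \<in> space M. waiting j \<omega> \<le> a} = 1 - ?p"
    by (subst prob_compl[symmetric]) (auto intro!: arg_cong[where f=prob])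
  ultimately show "\<P>(\<omega> in M. waiting j \<omega> \<le> a) = 1 - exp (- a * 1)" by simp
qed (simp_all add: measurable_waiting)

lemma prob_sum_waiting:
  assumes "x > 0"
  shows "prob {\<omega> \<in> space M. (\<Sum>j=1..K. waiting j \<omega>) \<ge> real K + x} \<le> real K / x\<^sup>2"
proof -
  let ?S = "\<lambda>\<omega>. \<Sum>j\<in>{1..K}. waiting j \<omega>"
  have "indep_vars (\<lambda>_. borel) (\<lambda>j \<omega>. real n * area (real_of_ereal (bin_min j \<omega>) - left_end j)) UNIV"
    by (rule indep_vars_compose2[OF indep_bin_min]) measurable
  hence "indep_vars (\<lambda>_. borel) waiting {1..K}"
    unfolding waiting_def[abs_def, symmetric] by (rule indep_vars_subset) simp
  hence D: "distributed M lborel ?S (erlang_density (card {1..K} - 1) 1)"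
    using K by (intro exponential_distributed_sum waiting_exponential) auto
  have E: "expectation ?S = real K"
    using erlang_ith_moment[OF _ D, of 1] K by (simp add: fact_reduce[of K])
  have V: "variance ?S = real K"
    using erlang_distributed_variance[OF _ D] K by simp
  have I: "integrable M (\<lambda>\<omega>. (?S \<omega>)\<^sup>2)"
    by (rule erlang_ith_moment_integrable[OF _ D]) simp
  have "prob {\<omega> \<in> space M. ?S \<omega> \<ge> real K + x} \<le> prob {\<omega> \<in> space M. x \<le> \<bar>?S \<omega> - expectation ?S\<bar>}"
    unfolding E by (intro finite_measure_mono) auto
  also have "\<dots> \<le> variance ?S / x\<^sup>2"
    using I assms by (intro Chebyshev_inequality) auto
  finally show ?thesis unfolding V .
qed

text \<open>Formulated on extended reals so that independence passes from \<open>bin_min\<close> by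
  composition. Below half the bin width the deficit is at least \<open>1 / (8 K)\<close>.\<close>

definition early :: "nat \<Rightarrow> ereal \<Rightarrow> real" where
  "early j b = (if b < ereal (left_end j + 1 / (2 * real K)) then 1 else 0)"

lemma measurable_early[measurable]: "early j \<in> borel_measurable borel"
  unfolding early_def[abs_def] by measurable

text \<open>The exponent is \<open>n\<close> times
  \<open>area (1 / (2 K)) = 1 / (8 K^2)\<close>.\<close>

definition p_early :: real where "p_early = 1 - exp (- (real n / (8 * real K ^ 2)))"

lemma prob_early:
  assumes j: "j \<in> {1..K}"
  shows "prob {\<omega> \<in> space M. bin_min j \<omega> < ereal (left_end j + 1 / (2 * real K))} = p_early"
proof -
  have "area (1 / (2 * real K)) = 1 / (8 * real K ^ 2)"
    using K by (simp add: area_def field_simps power2_eq_square)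
  hence "prob {\<omega> \<in> space M. ereal (left_end j + 1 / (2 * real K)) \<le> bin_min j \<omega>} = exp (- (real n / (8 * real K ^ 2)))"
    by (subst prob_bin_min_ge[OF j]) simp_all
  moreover have "prob {\<omega> \<in> space M. bin_min j \<omega> < ereal (left_end j + 1 / (2 * real K))} =
      1 - prob {\<omega> \<in> space M. ereal (left_end j + 1 / (2 * real K)) \<le> bin_min j \<omega>}"
    by (subst prob_compl[symmetric]) (auto intro!: arg_cong[where f=prob])
  ultimately show ?thesis by (simp add: p_early_def)
qed

lemma p_early_bounds: "0 \<le> p_early" "p_early \<le> 1" "min 1 (real n / real K ^ 2) / 10 \<le> p_early"
proof -
  show "0 \<le> p_early" "p_early \<le> 1" by (simp_all add: p_early_def)
  define v where "v = min 1 (real n / real K ^ 2)"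
  have v: "0 \<le> v" "v \<le> 1" "v \<le> real n / real K ^ 2" by (auto simp: v_def)
  have "exp (- (real n / (8 * real K ^ 2))) \<le> exp (- (v / 8))" using v by (simp add: field_simps)
  also have "\<dots> \<le> 1 / (1 + v / 8)"
    using exp_ge_add_one_self[of "v / 8"] v by (simp add: exp_minus inverse_eq_divide frac_le)
  \<comment> \<open>After clearing denominators this is \<open>v / 40 \<ge> v^2 / 80\<close>, which
    follows from \<open>v^2 \<le> v\<close>.\<close>
  also have "\<dots> \<le> 1 - v / 10"
  proof -
    have "v * v \<le> v * 1" using v by (intro mult_left_mono) auto
    thus ?thesis using v by (simp add: field_simps)
  qed
  finally show "min 1 (real n / real K ^ 2) / 10 \<le> p_early" unfolding p_early_def v_def by simp
qed

text \<open>Chernoff's method with parameter 1: each factor is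
  \<open>1 - (1 - exp (-1)) p \<le> exp (- p / 2)\<close>, and the exponent that remains is
  \<open>1/2 - 2/5 = 1/10\<close>.\<close>

lemma prob_few_early:
  "prob {\<omega> \<in> space M. (\<Sum>j=1..K. early j (bin_min j \<omega>)) \<le> 2 / 5 * (real K * p_early)} \<le> exp (- (real K * p_early / 10))"
proof -
  let ?S = "\<lambda>\<omega>. \<Sum>j=1..K. early j (bin_min j \<omega>)"
  let ?a = "2 / 5 * (real K * p_early)"
  have "indep_vars (\<lambda>_. borel) (\<lambda>j \<omega>. exp (- early j (bin_min j \<omega>))) UNIV"
    by (rule indep_vars_compose2[OF indep_bin_min]) measurable
  hence ind: "indep_vars (\<lambda>_. borel) (\<lambda>j \<omega>. exp (- early j (bin_min j \<omega>))) {1..K}"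
    by (rule indep_vars_subset) simp
  have early01: "0 \<le> early j b" for j b by (simp add: early_def)
  have int: "integrable M (\<lambda>\<omega>. exp (- early j (bin_min j \<omega>)))" for j
    by (rule integrable_const_bound[where B=1]) (auto simp: early01)
  have each: "expectation (\<lambda>\<omega>. exp (- early j (bin_min j \<omega>))) \<le> exp (- (p_early / 2))" if j: "j \<in> {1..K}" for j
  proof -
    let ?A = "{\<omega> \<in> space M. bin_min j \<omega> < ereal (left_end j + 1 / (2 * real K))}"
    have "expectation (\<lambda>\<omega>. exp (- early j (bin_min j \<omega>))) = expectation (\<lambda>\<omega>. 1 - (1 - exp (-1)) * indicator ?A \<omega>)"
      by (intro Bochner_Integration.integral_cong) (auto simp: early_def)
    also have "\<dots> = 1 - (1 - exp (-1)) * p_early"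
    proof -
      have *: "expectation (\<lambda>\<omega>. 1 - c * indicator A \<omega>) = 1 - c * prob A" if "A \<in> events" for c A
        using that by (simp add: prob_space less_top[symmetric])
      have "?A \<in> events" by measurable
      thus ?thesis unfolding prob_early[OF j, symmetric] by (rule *)
    qed
    also have "\<dots> \<le> 1 + - (p_early / 2)"
    proof -
      have "exp (-1) \<le> (1 / 2 :: real)" using exp_ge_add_one_self[of "1::real"] by (simp add: exp_minus field_simps)
      hence "1 / 2 * p_early \<le> (1 - exp (-1)) * p_early" using p_early_bounds by (intro mult_right_mono) auto
      thus ?thesis by simp
    qed
    also have "\<dots> \<le> exp (- (p_early / 2))" by (rule exp_ge_add_one_self)
    finally show ?thesis .
  qed
  have prod: "exp (- ?S \<omega>) = (\<Prod>j\<in>{1..K}. exp (- early j (bin_min j \<omega>)))" for \<omega>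
    by (simp add: exp_sum[symmetric] sum_negf)
  have "expectation (\<lambda>\<omega>. exp (- ?S \<omega>)) = (\<Prod>j\<in>{1..K}. expectation (\<lambda>\<omega>. exp (- early j (bin_min j \<omega>))))"
    unfolding prod using int by (intro indep_vars_lebesgue_integral ind) auto
  also have "\<dots> \<le> (\<Prod>j\<in>{1..K}. exp (- (p_early / 2)))"
    by (intro prod_mono conjI each integral_nonneg_AE) auto
  also have "\<dots> = exp (- (real K * p_early / 2))"
    by (simp add: exp_of_nat_mult[symmetric])
  finally have E: "expectation (\<lambda>\<omega>. exp (- ?S \<omega>)) \<le> exp (- (real K * p_early / 2))" .
  have intS: "integrable M (\<lambda>\<omega>. exp (- ?S \<omega>))"
    unfolding prod using int by (intro indep_vars_integrable ind) auto
  have "prob {\<omega> \<in> space M. ?S \<omega> \<le> ?a} = prob {\<omega> \<in> space M. exp (- ?a) \<le> exp (- ?S \<omega>)}" by simp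
  also have "\<dots> \<le> expectation (\<lambda>\<omega>. exp (- ?S \<omega>)) / exp (- ?a)"
    by (rule integral_Markov_inequality_measure[OF intS]) (auto intro: sets.top)
  also have "\<dots> \<le> exp (- (real K * p_early / 2)) / exp (- ?a)"
    using E by (intro divide_right_mono) auto
  also have "\<dots> = exp (- (real K * p_early / 10))"
    unfolding exp_diff[symmetric] by simp
  finally show ?thesis .
qed

text \<open>The deficit \<open>K/2 (1/K - D)\<^sub>+\<^sup>2\<close> of the exponential approximation is the source of the bias.\<close>

lemma deviation_le:
  assumes "D \<ge> 0"
  shows "D - 1 / (2 * real K) \<le> real K * area D - (if D < 1 / (2 * real K) then 1 / (8 * real K) else 0)"
proof -
  have K0: "real K > 0" using K by simp
  show ?thesis
  proof (cases "D < 1 / (2 * real K)")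
    case True
    have "1 / (2 * real K) \<le> 1 / real K - D" using True K0 by (simp add: field_simps)
    hence "(1 / (2 * real K))\<^sup>2 \<le> (1 / real K - D)\<^sup>2" using K0 by (intro power_mono) auto
    hence "real K / 2 * (1 / (2 * real K))\<^sup>2 \<le> real K / 2 * (1 / real K - D)\<^sup>2" using K0 by (intro mult_left_mono) auto
    moreover have "real K / 2 * (1 / (2 * real K))\<^sup>2 = 1 / (8 * real K)"
      using K0 by (simp add: field_simps power2_eq_square)
    moreover have "real K / 2 * (1 / real K - D)\<^sup>2 = real K * (D\<^sup>2 / 2) - (D - 1 / (2 * real K))"
      using K0 by (simp add: field_simps power2_eq_square)
    moreover have "D \<le> 1 / real K"
    proof -
      have "1 / (2 * real K) \<le> 1 / real K" using K0 by (simp add: field_simps)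
      thus ?thesis using True by linarith
    qed
    ultimately show ?thesis using True by (simp add: area_def)
  next
    case False
    have "real K * (D / real K - 1 / (2 * real K ^ 2)) \<le> real K * area D"
      using area_ge[OF assms] K0 by (intro mult_left_mono) auto
    moreover have "real K * (D / real K - 1 / (2 * real K ^ 2)) = D - 1 / (2 * real K)"
      using K0 by (simp add: field_simps power2_eq_square)
    ultimately show ?thesis using False by simp
  qed
qed

text \<open>The midpoints \<open>left_end j + 1 / (2 K)\<close> average to 1/2, so averaging
  \<open>deviation_le\<close> over the bins bounds the error of the estimator.\<close>

lemma mle_error_le:
  assumes reg: "regular \<omega>"
  shows "mle \<omega> - 1 / 2 \<le> (\<Sum>j=1..K. waiting j \<omega>) / real n - (\<Sum>j=1..K. early j (bin_min j \<omega>)) / (8 * real K ^ 2)"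
proof -
  have K0: "real K > 0" using K by simp
  have each: "h j \<omega> - left_end j - 1 / (2 * real K) \<le> real K / real n * waiting j \<omega> - early j (bin_min j \<omega>) / (8 * real K)"
    if j: "j \<in> {1..K}" for j
  proof -
    have b: "bin_min j \<omega> = ereal (h j \<omega>)" using regular_bin(3)[OF reg j] by simp
    have "h j \<omega> - left_end j - 1 / (2 * real K) \<le> real K * area (h j \<omega> - left_end j) -
      (if h j \<omega> - left_end j < 1 / (2 * real K) then 1 / (8 * real K) else 0)"
      using regular_bin(4)[OF reg j] by (intro deviation_le) simp
    also have "real K * area (h j \<omega> - left_end j) = real K / real n * waiting j \<omega>"
      using n by (simp add: waiting_def b)
    also have "(if h j \<omega> - left_end j < 1 / (2 * real K) then 1 / (8 * real K) else 0) = early j (bin_min j \<omega>) / (8 * real K)"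
      by (auto simp: early_def b algebra_simps)
    finally show ?thesis .
  qed
  have "(\<Sum>j=1..K. h j \<omega> - left_end j - 1 / (2 * real K)) \<le>
    (\<Sum>j=1..K. real K / real n * waiting j \<omega> - early j (bin_min j \<omega>) / (8 * real K))"
    by (intro sum_mono each)
  also have "\<dots> = real K * ((\<Sum>j=1..K. waiting j \<omega>) / real n - (\<Sum>j=1..K. early j (bin_min j \<omega>)) / (8 * real K ^ 2))"
    using K0 by (simp add: sum_subtractf sum_distrib_left[symmetric] sum_divide_distrib[symmetric] right_diff_distrib power2_eq_square)
  also have "(\<Sum>j=1..K. h j \<omega> - left_end j - 1 / (2 * real K)) = real K * (mle \<omega> - 1 / 2)"
  proof -
    have "(\<Sum>j=1..K. h j \<omega> - left_end j - 1 / (2 * real K)) = (\<Sum>j=1..K. h j \<omega>) - (real K - 1) / 2 - 1 / 2"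
      using K0 sum_left_ends[OF K] by (simp add: sum_subtractf)
    also have "\<dots> = real K * (mle \<omega> - 1 / 2)"
      using K0 unfolding theta_mle_def theta_step_fun[OF K] by (simp add: field_simps)
    finally show ?thesis .
  qed
  finally show ?thesis using K0 by (simp add: mult_le_cancel_left_pos)
qed

text \<open>Bookkeeping in units of \<open>v / K\<close>: at least \<open>K v / 25\<close> early
  bins, each worth \<open>1 / (8 K^2)\<close>, give a bias of 1/200; the fluctuation
  \<open>x / n\<close> takes back 1/1000; the radius is 1/256. The event therefore forces too few
  early bins or a large sum of waiting times.\<close>

lemma prob_mle_not_far_below:
  defines "v \<equiv> min 1 (real n / real K ^ 2)"
  shows "prob {\<omega> \<in> space M. 1 / 2 \<le> mle \<omega> - real K / real n + sqrt (real K) / real n * rho n K}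
    \<le> exp (- (real K * v / 100)) + 10 ^ 6 * real K ^ 3 / (real n ^ 2 * v ^ 2)"
proof -
  have K0: "real K > 0" and n0: "real n > 0" using K n by simp_all
  have v: "v > 0" using K0 n0 by (simp add: v_def)
  define x where "x = real n * v / (1000 * real K)" \<comment> \<open>\<open>1/1000 < 1/200 - 1/256\<close>\<close>
  have x: "x > 0" using K0 n0 v by (simp add: x_def)
  let ?T = "\<lambda>\<omega>. \<Sum>j=1..K. waiting j \<omega>" and ?S = "\<lambda>\<omega>. \<Sum>j=1..K. early j (bin_min j \<omega>)"
  let ?A = "{\<omega> \<in> space M. 1 / 2 \<le> mle \<omega> - real K / real n + sqrt (real K) / real n * rho n K}"
  let ?B = "{\<omega> \<in> space M. ?S \<omega> \<le> 2 / 5 * (real K * p_early)}"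
  let ?C = "{\<omega> \<in> space M. ?T \<omega> \<ge> real K + x}"
  have BC: "?B \<in> events" "?C \<in> events" by measurable
  have "prob ?A \<le> prob (?B \<union> ?C)"
  proof (rule finite_measure_mono_AE)
    show "AE \<omega> in M. \<omega> \<in> ?A \<longrightarrow> \<omega> \<in> ?B \<union> ?C"
      using AE_regular
    proof eventually_elim
      case (elim \<omega>)
      show ?case
      proof (intro impI, rule ccontr)
        assume A: "\<omega> \<in> ?A" and "\<omega> \<notin> ?B \<union> ?C"
        hence S: "2 / 5 * (real K * p_early) < ?S \<omega>" and T: "?T \<omega> < real K + x" by auto
        have "real K * v / 25 = 2 / 5 * (real K * (v / 10))" by simp
        also have "\<dots> \<le> 2 / 5 * (real K * p_early)"
          using p_early_bounds(3) K0 by (intro mult_left_mono) (auto simp: v_def)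
        also note S
        finally have "real K * v / 25 < ?S \<omega>" .
        hence "real K * v / 25 / (8 * real K ^ 2) < ?S \<omega> / (8 * real K ^ 2)"
          using K0 by (intro divide_strict_right_mono) auto
        hence S': "v / real K / 200 < ?S \<omega> / (8 * real K ^ 2)"
          using K0 by (simp add: power2_eq_square)
        have "?T \<omega> / real n < (real K + x) / real n" using T n0 by (intro divide_strict_right_mono) auto
        also have "\<dots> = real K / real n + v / real K / 1000"
          using n0 by (simp add: x_def add_divide_distrib)
        finally have T': "?T \<omega> / real n < real K / real n + v / real K / 1000" .
        have "sqrt (real K) / real n * rho n K = v / real K / 256"
          unfolding sqrt_mult_rho[OF K] v_def by simp
        hence "1 / 2 \<le> mle \<omega> - real K / real n + v / real K / 256" using A by simp
        moreover have "v / real K > 0" using v K0 by simp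
        \<comment> \<open>Naming the quotients makes the contradiction linear: it would need
          \<open>w / 256 > w / 250\<close> with \<open>w > 0\<close>.\<close>
        moreover have False if "1 / 2 \<le> m - k + w / 256" "w > 0" "m - 1 / 2 \<le> t - e" "w / 200 < e" "t < k + w / 1000"
          for m k w t e :: real using that by linarith
        ultimately show False using mle_error_le[OF elim] S' T' by blast
      qed
    qed
  qed (use BC in auto)
  also have "\<dots> \<le> prob ?B + prob ?C" by (rule measure_Un_le[OF BC])
  also have "\<dots> \<le> exp (- (real K * p_early / 10)) + real K / x\<^sup>2"
    using prob_few_early prob_sum_waiting[OF x] by (rule add_mono)
  also have "\<dots> \<le> exp (- (real K * v / 100)) + 10 ^ 6 * real K ^ 3 / (real n ^ 2 * v ^ 2)"
  proof (rule add_mono)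
    have "real K * (v / 10) \<le> real K * p_early" using p_early_bounds(3) by (intro mult_left_mono) (auto simp: v_def)
    thus "exp (- (real K * p_early / 10)) \<le> exp (- (real K * v / 100))" by (simp add: mult.commute)
    show "real K / x\<^sup>2 \<le> 10 ^ 6 * real K ^ 3 / (real n ^ 2 * v ^ 2)"
      using K0 n0 v by (simp add: x_def field_simps power2_eq_square power3_eq_cube)
  qed
  finally show ?thesis .
qed

end

section \<open>Limits\<close>

lemma theta_identity:
  assumes "\<forall>x\<in>{0..1}. f x = x"
  shows "theta f = 1 / 2"
proof -
  have "theta f = (\<integral>x. x * indicator {0..1::real} x \<partial>lborel)"
    unfolding theta_def set_lebesgue_integral_def using assms
    by (intro Bochner_Integration.integral_cong) (auto simp: indicator_def)
  also have "\<dots> = 1\<^sup>2 / 2 - 0\<^sup>2 / 2"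
    by (rule integral_FTC_Icc_nonneg[where F="\<lambda>x. x\<^sup>2 / 2"])
       (auto intro!: derivative_eq_intros simp: has_real_derivative_iff_has_vector_derivative[symmetric])
  finally show ?thesis by simp
qed

text \<open>From \<open>n / K \<ge> ln n\<close> the exponential is at most \<open>1 / n^2\<close>,
  and \<open>K \<le> n\<close> leaves \<open>1 / n\<close>. It is applied with \<open>c = R\<close>
  and \<open>c = R - 1\<close>.\<close>

lemma bins_times_exp_tendsto_0:
  fixes K :: "nat \<Rightarrow> nat"
  assumes K_pos: "\<And>n. K n > 0"
    and K_le: "\<And>n. n \<ge> 2 \<Longrightarrow> real (K n) \<le> real n / ln (real n)"
    and c: "c \<ge> 2"
  shows "(\<lambda>n. real (K n) * exp (- (real n / real (K n) * c))) \<longlonglongrightarrow> 0"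
proof (rule tendsto_sandwich[OF _ _ tendsto_const lim_inverse_n])
  show "\<forall>\<^sub>F n in sequentially. 0 \<le> real (K n) * exp (- (real n / real (K n) * c))" by simp
  have "\<forall>\<^sub>F n in sequentially. ln (real n) \<ge> 1" by real_asymp
  thus "\<forall>\<^sub>F n in sequentially. real (K n) * exp (- (real n / real (K n) * c)) \<le> inverse (of_nat n)"
    using eventually_ge_at_top[of 2]
  proof eventually_elim
    case (elim n)
    have n: "real n > 0" using elim by simp
    have K: "real (K n) > 0" using K_pos by simp
    have "real (K n) * ln (real n) \<le> real n" using K_le[of n] elim by (simp add: field_simps)
    hence "ln (real n) \<le> real n / real (K n)" using K by (simp add: field_simps)
    hence "ln (real n) * 2 \<le> real n / real (K n) * c" using c elim by (intro mult_mono) auto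
    hence "exp (- (real n / real (K n) * c)) \<le> exp (- (ln (real n) * 2))" by simp
    also have "\<dots> = inverse (real n ^ 2)"
      using n by (simp add: exp_minus exp_double power2_eq_square mult.commute[of _ 2])
    finally have "real (K n) * exp (- (real n / real (K n) * c)) \<le> real n * inverse (real n ^ 2)"
    proof (intro mult_mono)
      have "real (K n) * 1 \<le> real (K n) * ln (real n)" using elim K by (intro mult_left_mono) auto
      thus "real (K n) \<le> real n" using \<open>real (K n) * ln (real n) \<le> real n\<close> by simp
    qed auto
    also have "real n * inverse (real n ^ 2) = inverse (real n)" using n by (simp add: power2_eq_square)
    finally show ?case .
  qed
qed

text \<open>The regimes \<open>v = 1\<close> and \<open>v = n / k^2\<close> yield one summand each;
  the sum avoids carrying the case distinction into the limit.\<close>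

lemma min_one_ratio_bounds:
  fixes n k :: real
  assumes "n > 0" "k > 0"
  defines "v \<equiv> min 1 (n / k ^ 2)"
  shows "k ^ 3 / (n ^ 2 * v ^ 2) \<le> k ^ 3 / n ^ 2 + k ^ 7 / n ^ 4" and "k * v = min k (n / k)"
proof -
  show "k * v = min k (n / k)"
    using assms by (simp add: v_def min_def field_simps power2_eq_square)
  show "k ^ 3 / (n ^ 2 * v ^ 2) \<le> k ^ 3 / n ^ 2 + k ^ 7 / n ^ 4"
  proof (cases "n / k ^ 2 \<le> 1")
    case True
    hence "v = n / k ^ 2" by (simp add: v_def)
    hence "n ^ 2 * v ^ 2 = n ^ 4 / k ^ 4" by (simp add: power_divide flip: power_mult power_add)
    hence "k ^ 3 / (n ^ 2 * v ^ 2) = k ^ 7 / n ^ 4" by (simp flip: power_add)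
    thus ?thesis using assms(1,2) by simp
  next
    case False
    hence "v = 1" by (simp add: v_def)
    thus ?thesis using assms(1,2) by simp
  qed
qed

text \<open>With \<open>r = K / n powr (4 / 7)\<close> the term \<open>K^7 / n^4\<close> is exactly
  \<open>r^7\<close>, while \<open>K^3 / n^2 \<le> r^3\<close> because
  \<open>12 / 7 \<le> 2\<close>.\<close>

lemma fluctuation_tendsto_0:
  fixes K :: "nat \<Rightarrow> nat"
  assumes K_pos: "\<And>n. K n > 0"
    and o: "(\<lambda>n. real (K n)) \<in> o(\<lambda>n. real n powr (4 / 7))"
  shows "(\<lambda>n. real (K n) ^ 3 / (real n ^ 2 * min 1 (real n / real (K n) ^ 2) ^ 2)) \<longlonglongrightarrow> 0"
proof (rule tendsto_sandwich[OF _ _ tendsto_const])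
  define r where "r = (\<lambda>n. real (K n) / real n powr (4 / 7))"
  have r: "r \<longlonglongrightarrow> 0" unfolding r_def by (rule smalloD_tendsto[OF o])
  show "\<forall>\<^sub>F n in sequentially. 0 \<le> real (K n) ^ 3 / (real n ^ 2 * min 1 (real n / real (K n) ^ 2) ^ 2)"
    by simp
  show "\<forall>\<^sub>F n in sequentially. real (K n) ^ 3 / (real n ^ 2 * min 1 (real n / real (K n) ^ 2) ^ 2) \<le> r n ^ 3 + r n ^ 7"
    using eventually_ge_at_top[of 1]
  proof eventually_elim
    case (elim n)
    have n: "real n > 0" "real n \<ge> 1" using elim by auto
    have p: "(real n powr (4 / 7)) ^ m = real n powr (4 / 7 * real m)" for m
      using n by (simp add: powr_realpow[symmetric] powr_powr)
    have "(real n powr (4 / 7)) ^ 7 = real n powr (real 4)" unfolding p by simp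
    also have "\<dots> = real n ^ 4" using n by (intro powr_realpow)
    finally have 7: "r n ^ 7 = real (K n) ^ 7 / real n ^ 4" by (simp add: r_def power_divide)
    have "(real n powr (4 / 7)) ^ 3 \<le> real n powr (real 2)"
      unfolding p using n by (intro powr_mono) auto
    also have "\<dots> = real n ^ 2" using n by (intro powr_realpow)
    finally have "real (K n) ^ 3 / real n ^ 2 \<le> real (K n) ^ 3 / (real n powr (4 / 7)) ^ 3"
      using n by (intro divide_left_mono) auto
    hence 3: "real (K n) ^ 3 / real n ^ 2 \<le> r n ^ 3" by (simp add: r_def power_divide)
    have "real (K n) > 0" using K_pos by simp
    from min_one_ratio_bounds(1)[OF n(1) this] show ?case using 3 7 by simp
  qed
  have "(\<lambda>n. r n ^ 3 + r n ^ 7) \<longlonglongrightarrow> 0 ^ 3 + 0 ^ 7" by (intro tendsto_intros r)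
  thus "(\<lambda>n. r n ^ 3 + r n ^ 7) \<longlonglongrightarrow> 0" by simp
qed

text \<open>The Chernoff exponent is governed by \<open>K v = min K (n / K)\<close>. Both terms
  diverge, the second because it is at least \<open>ln n\<close>.\<close>

lemma coverage_bound_tendsto_0:
  fixes K :: "nat \<Rightarrow> nat"
  assumes K_pos: "\<And>n. K n > 0"
    and K_le: "\<And>n. n \<ge> 2 \<Longrightarrow> real (K n) \<le> real n / ln (real n)"
    and K_lim: "filterlim K at_top sequentially"
    and o: "(\<lambda>n. real (K n)) \<in> o(\<lambda>n. real n powr (4 / 7))"
  defines "v \<equiv> \<lambda>n. min 1 (real n / real (K n) ^ 2)"
  shows "(\<lambda>n. exp (- (real (K n) * v n / 100)) + 10 ^ 6 * real (K n) ^ 3 / (real n ^ 2 * v n ^ 2)) \<longlonglongrightarrow> 0"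
proof -
  have K_at_top: "filterlim (\<lambda>n. real (K n)) at_top sequentially"
    by (rule filterlim_compose[OF filterlim_real_sequentially K_lim])
  have "filterlim (\<lambda>n. real n / real (K n)) at_top sequentially"
  proof (rule filterlim_at_top_mono)
    show "filterlim (\<lambda>n. ln (real n)) at_top sequentially" by real_asymp
    show "\<forall>\<^sub>F n in sequentially. ln (real n) \<le> real n / real (K n)"
      using eventually_ge_at_top[of 2]
    proof eventually_elim
      case (elim n)
      have "ln (real n) > 0" using elim by simp
      thus ?case using K_le[OF elim] K_pos[of n] by (simp add: field_simps)
    qed
  qed
  hence "\<forall>\<^sub>F n in sequentially. Z \<le> real (K n) * v n" for Z
    unfolding filterlim_at_top
  proof -
    assume "\<forall>Z. \<forall>\<^sub>F n in sequentially. Z \<le> real n / real (K n)"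
    hence "\<forall>\<^sub>F n in sequentially. Z \<le> real n / real (K n)" by blast
    thus ?thesis
      using K_at_top[unfolded filterlim_at_top, rule_format, of Z] eventually_gt_at_top[of 0]
    proof eventually_elim
      case (elim n)
      have "real (K n) * v n = min (real (K n)) (real n / real (K n))"
        unfolding v_def using elim K_pos by (intro min_one_ratio_bounds(2)) auto
      thus ?case using elim by simp
    qed
  qed
  hence Kv: "filterlim (\<lambda>n. real (K n) * v n) at_top sequentially" by (simp add: filterlim_at_top)
  have "((\<lambda>x::real. exp (- (x / 100))) \<longlongrightarrow> 0) at_top" by real_asymp
  from filterlim_compose[OF this Kv] have 1: "(\<lambda>n. exp (- (real (K n) * v n / 100))) \<longlonglongrightarrow> 0" .
  have 2: "(\<lambda>n. real (K n) ^ 3 / (real n ^ 2 * v n ^ 2)) \<longlonglongrightarrow> 0"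
    unfolding v_def by (rule fluctuation_tendsto_0[OF K_pos o])
  have "(\<lambda>n. exp (- (real (K n) * v n / 100)) + 10 ^ 6 * (real (K n) ^ 3 / (real n ^ 2 * v n ^ 2))) \<longlonglongrightarrow> 0 + 10 ^ 6 * 0"
    by (intro tendsto_intros 1 2)
  thus ?thesis by simp
qed

text \<open>The square of \<open>rho\<close> is the reciprocal of the Chebyshev ratio up to the
  factor \<open>65536 = 256^2\<close>, so the same limit serves again.\<close>

lemma rho_at_top:
  fixes K :: "nat \<Rightarrow> nat"
  assumes K_pos: "\<And>n. K n > 0"
    and o: "(\<lambda>n. real (K n)) \<in> o(\<lambda>n. real n powr (4 / 7))"
  shows "\<forall>\<^sub>F n in sequentially. q \<le> rho n (K n)"
proof -
  define e where "e = (\<lambda>n. real (K n) ^ 3 / (real n ^ 2 * min 1 (real n / real (K n) ^ 2) ^ 2))"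
  have "e \<longlonglongrightarrow> 0" unfolding e_def by (rule fluctuation_tendsto_0[OF K_pos o])
  \<comment> \<open>Adding 1 to \<open>q^2\<close> keeps the denominator positive also for
    \<open>q = 0\<close>.\<close>
  hence "\<forall>\<^sub>F n in sequentially. e n < 1 / (65536 * (q\<^sup>2 + 1))"
    by (rule order_tendstoD(2)) (simp add: add_nonneg_pos)
  thus ?thesis using eventually_gt_at_top[of 0]
  proof eventually_elim
    case (elim n)
    define v where "v = min 1 (real n / real (K n) ^ 2)"
    have pos: "real n > 0" "real (K n) > 0" using elim K_pos by auto
    hence v: "v > 0" by (simp add: v_def)
    have rho0: "rho n (K n) \<ge> 0" by (simp add: rho_def)
    have s: "sqrt (real (K n)) > 0" using pos by simp
    have "rho n (K n) = real n / sqrt (real (K n)) * (v / (256 * real (K n)))"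
      using sqrt_mult_rho[OF K_pos, of n n] pos s by (simp add: v_def[symmetric] field_simps)
    hence "(rho n (K n))\<^sup>2 = real n ^ 2 * v ^ 2 / (65536 * real (K n) ^ 3)"
      using pos by (simp only: power_mult_distrib power_divide real_sqrt_pow2 of_nat_0_le_iff)
        (simp add: power2_eq_square power3_eq_cube)
    also have "\<dots> = 1 / (65536 * e n)" unfolding e_def v_def[symmetric] using pos v by (simp add: field_simps)
    finally have r2: "(rho n (K n))\<^sup>2 = 1 / (65536 * e n)" .
    have e: "e n > 0" unfolding e_def v_def[symmetric] using pos v by simp
    have "e n * (65536 * (q\<^sup>2 + 1)) < 1"
      by (rule pos_less_divide_eq[THEN iffD1, OF _ elim(1)]) (simp add: add_nonneg_pos)
    hence "q\<^sup>2 + 1 < 1 / (65536 * e n)" using e by (simp add: field_simps)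
    hence "q\<^sup>2 \<le> (rho n (K n))\<^sup>2" using r2 by simp
    thus ?case using rho0 by (rule power2_le_imp_le)
  qed
qed

theorem theorem4p4:
  fixes M :: "nat \<Rightarrow> 'w measure"
    and X Y :: "nat \<Rightarrow> nat \<Rightarrow> 'w \<Rightarrow> real"
    and K :: "nat \<Rightarrow> nat"
    and R \<theta>\<^sub>0 :: real
    and f\<^sub>0 :: "real \<Rightarrow> real"
  assumes f0: "\<forall>x\<in>{0..1}. f\<^sub>0 x = x"
    and theta0: "\<theta>\<^sub>0 = theta f\<^sub>0"
    and model: "\<And>n. n \<ge> 1 \<Longrightarrow> boundary_model (M n) n f\<^sub>0 (X n) (Y n)"
    and K_pos: "\<And>n. K n > 0"
    and K_le: "\<And>n. n \<ge> 2 \<Longrightarrow> real (K n) \<le> real n / ln (real n)"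
    and K_lim: "filterlim K at_top sequentially"
    and R: "R > 3"
  shows "\<theta>\<^sub>0 = 1 / 2 \<and>
    (\<lambda>n. LINT \<omega>|M n.
        tv_dist (posterior_theta n (K n) R (\<lambda>i. X n i \<omega>) (\<lambda>i. Y n i \<omega>))
          (normal_law (theta_mle (K n) (\<lambda>i. X n i \<omega>) (\<lambda>i. Y n i \<omega>) - real (K n) / real n)
             (real (K n) / real n ^ 2))) \<longlonglongrightarrow> 0 \<and>
    (\<forall>\<alpha>\<in>{0<..<1}.
      (\<lambda>n. LINT \<omega>|M n.
          measure (posterior_theta n (K n) R (\<lambda>i. X n i \<omega>) (\<lambda>i. Y n i \<omega>))
            (credible_interval n (K n) (\<lambda>i. X n i \<omega>) (\<lambda>i. Y n i \<omega>) \<alpha>)) \<longlonglongrightarrow> 1 - \<alpha>) \<and>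
    ((\<lambda>n. real (K n)) \<in> o(\<lambda>n. real n powr (4 / 7)) \<longrightarrow>
      (\<lambda>n. measure (M n) {\<omega>\<in>space (M n).
          \<theta>\<^sub>0 \<le> theta_mle (K n) (\<lambda>i. X n i \<omega>) (\<lambda>i. Y n i \<omega>) - real (K n) / real n
                 + sqrt (real (K n)) / real n * rho n (K n)}) \<longlonglongrightarrow> 0 \<and>
      (\<forall>\<alpha>\<in>{0<..<1}.
        (\<lambda>n. measure (M n) {\<omega>\<in>space (M n).
            \<theta>\<^sub>0 \<in> credible_interval n (K n) (\<lambda>i. X n i \<omega>) (\<lambda>i. Y n i \<omega>) \<alpha>}) \<longlonglongrightarrow> 0))"
proof -
  have sample: "boundary_sample (M n) n (K n) f\<^sub>0 (X n) (Y n)" if "n \<ge> 1" for n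
    using that model[OF that] f0 K_pos by unfold_locales auto
  have \<theta>: "\<theta>\<^sub>0 = 1 / 2" using theta0 theta_identity[OF f0] by simp
  define \<delta> where "\<delta> = (\<lambda>n. boundary_sample.tv_bound n (K n) R
    + real (K n) * exp (- (real n / real (K n) * (R - 1))))"
  have \<delta>: "\<delta> \<longlonglongrightarrow> 0"
  proof -
    have "(\<lambda>n. normal_approx_error (K n) + real (K n) * exp (- (real n / real (K n) * R))
        + real (K n) * exp (- (real n / real (K n) * (R - 1)))) \<longlonglongrightarrow> 0 + 0 + 0"
      using R by (intro tendsto_add filterlim_compose[OF normal_approx_error_tendsto_0 K_lim]
        bins_times_exp_tendsto_0[of K, OF K_pos K_le]) auto
    hence "(\<lambda>n. normal_approx_error (K n) + real (K n) * exp (- (real n / real (K n) * R))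
        + real (K n) * exp (- (real n / real (K n) * (R - 1)))) \<longlonglongrightarrow> 0" by simp
    \<comment> \<open>The defining equation of \<open>tv_bound\<close> is available under the locale
      assumptions, hence for \<open>n \<ge> 1\<close>; the limit needs no more.\<close>
    moreover have "\<forall>\<^sub>F n in sequentially. normal_approx_error (K n) + real (K n) * exp (- (real n / real (K n) * R))
        + real (K n) * exp (- (real n / real (K n) * (R - 1))) = \<delta> n"
      using eventually_ge_at_top[of 1]
    proof eventually_elim
      case (elim n)
      thus ?case using boundary_sample.tv_bound_def[OF sample[OF elim], of R] by (simp add: \<delta>_def)
    qed
    ultimately show ?thesis by (rule Lim_transform_eventually)
  qed
  have tv: "(\<lambda>n. LINT \<omega>|M n.
        tv_dist (posterior_theta n (K n) R (\<lambda>i. X n i \<omega>) (\<lambda>i. Y n i \<omega>))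
          (normal_law (theta_mle (K n) (\<lambda>i. X n i \<omega>) (\<lambda>i. Y n i \<omega>) - real (K n) / real n)
             (real (K n) / real n ^ 2))) \<longlonglongrightarrow> 0"
  proof (rule tendsto_sandwich[OF _ _ tendsto_const \<delta>], goal_cases)
    case 1
    show ?case using eventually_ge_at_top[of 1]
      by eventually_elim (use R in \<open>intro boundary_sample.expectation_tv_dist(1)[OF sample], auto\<close>)
  next
    case 2
    show ?case using eventually_ge_at_top[of 1] unfolding \<delta>_def
      by eventually_elim (use R in \<open>intro boundary_sample.expectation_tv_dist(2)[OF sample], auto\<close>)
  qed
  have cred: "(\<lambda>n. LINT \<omega>|M n.
          measure (posterior_theta n (K n) R (\<lambda>i. X n i \<omega>) (\<lambda>i. Y n i \<omega>))
            (credible_interval n (K n) (\<lambda>i. X n i \<omega>) (\<lambda>i. Y n i \<omega>) \<alpha>)) \<longlonglongrightarrow> 1 - \<alpha>"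
    if \<alpha>: "\<alpha> \<in> {0<..<1}" for \<alpha>
  proof (rule LIM_zero_cancel, rule Lim_null_comparison[OF _ \<delta>])
    show "\<forall>\<^sub>F n in sequentially. norm ((LINT \<omega>|M n.
          measure (posterior_theta n (K n) R (\<lambda>i. X n i \<omega>) (\<lambda>i. Y n i \<omega>))
            (credible_interval n (K n) (\<lambda>i. X n i \<omega>) (\<lambda>i. Y n i \<omega>) \<alpha>)) - (1 - \<alpha>)) \<le> \<delta> n"
      using eventually_ge_at_top[of 1] unfolding \<delta>_def real_norm_def
      by eventually_elim (use R \<alpha> in \<open>intro boundary_sample.expectation_credible[OF sample], auto\<close>)
  qed
  have cover: "(\<lambda>n. measure (M n) {\<omega>\<in>space (M n).
          \<theta>\<^sub>0 \<le> theta_mle (K n) (\<lambda>i. X n i \<omega>) (\<lambda>i. Y n i \<omega>) - real (K n) / real n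
                 + sqrt (real (K n)) / real n * rho n (K n)}) \<longlonglongrightarrow> 0"
    if o: "(\<lambda>n. real (K n)) \<in> o(\<lambda>n. real n powr (4 / 7))"
  proof (rule tendsto_sandwich[OF _ _ tendsto_const coverage_bound_tendsto_0[of K, OF K_pos K_le K_lim o]], goal_cases)
    case 1 show ?case by simp
  next
    case 2
    show ?case unfolding \<theta> using eventually_ge_at_top[of 1]
      by eventually_elim (rule boundary_sample.prob_mle_not_far_below[OF sample])
  qed
  have "(\<lambda>n. measure (M n) {\<omega>\<in>space (M n).
            \<theta>\<^sub>0 \<in> credible_interval n (K n) (\<lambda>i. X n i \<omega>) (\<lambda>i. Y n i \<omega>) \<alpha>}) \<longlonglongrightarrow> 0"
    if o: "(\<lambda>n. real (K n)) \<in> o(\<lambda>n. real n powr (4 / 7))" and \<alpha>: "\<alpha> \<in> {0<..<1}" for \<alpha>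
  proof (rule tendsto_sandwich[OF _ _ tendsto_const cover[OF o]])
    show "\<forall>\<^sub>F n in sequentially. 0 \<le> measure (M n) {\<omega>\<in>space (M n).
            \<theta>\<^sub>0 \<in> credible_interval n (K n) (\<lambda>i. X n i \<omega>) (\<lambda>i. Y n i \<omega>) \<alpha>}" by simp
    show "\<forall>\<^sub>F n in sequentially. measure (M n) {\<omega>\<in>space (M n).
            \<theta>\<^sub>0 \<in> credible_interval n (K n) (\<lambda>i. X n i \<omega>) (\<lambda>i. Y n i \<omega>) \<alpha>} \<le>
          measure (M n) {\<omega>\<in>space (M n).
          \<theta>\<^sub>0 \<le> theta_mle (K n) (\<lambda>i. X n i \<omega>) (\<lambda>i. Y n i \<omega>) - real (K n) / real n
                 + sqrt (real (K n)) / real n * rho n (K n)}"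
      \<comment> \<open>Once \<open>rho\<close> exceeds the fixed quantile, the upper end of the
        interval lies below the level in \<open>cover\<close>, so coverage implies that
        event.\<close>
      using rho_at_top[of K, OF K_pos o, of "normal_quantile (1 - \<alpha> / 2)"] eventually_ge_at_top[of 1]
    proof eventually_elim
      case (elim n)
      interpret boundary_sample "M n" n "K n" f\<^sub>0 "X n" "Y n" by (rule sample[OF elim(2)])
      have "sqrt (real (K n)) / real n * normal_quantile (1 - \<alpha> / 2) \<le> sqrt (real (K n)) / real n * rho n (K n)"
        using elim(1) by (intro mult_left_mono) auto
      thus ?case by (intro finite_measure_mono) (auto simp: credible_interval_def)
    qed
  qed
  with \<theta> tv cred cover show ?thesis by blast
qed

end
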